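(* Let $p\in[2,\infty[$ and let $(\mathbb B,|\cdot|_{\mathbb B})$ be a separable Banach space belonging to the class $\widetilde{\mathcal C}_2(p,\tilde c_p)$. Let $(X_i)_{i\ge1}$ be a sequence of centered random variables with values in $\mathbb B$ such that $\mathbb E|X_i|_{\mathbb B}^p<\infty$ for all $i$. Let $(\mathcal F_i)_{i\ge0}$ be an increasing sequence of $\sigma$-algebras such that $X_i$ is $\mathcal F_i$-measurable for each $i$, and write $\mathbb E_i(\cdot)=\mathbb E(\cdot\mid\mathcal F_i)$. Let $S_n=\sum_{i=1}^nX_i$ and $$b_{i,n}=\max_{i\le \ell\le n}\Big(\mathbb E_0\Big(|X_i|_{\mathbb B}^{p/2}\Big|\sum_{k=i}^{\ell}\mathbb E_i(X_k)\Big|_{\mathbb B}^{p/2}\Big)\Big)^{2/p}.$$ Then for every integer $n\ge0$, almost surely, $$\mathbb E_0(|S_n|_{\mathbb B}^p)\le K^p\Big(\sum_{i=1}^n b_{i,n}\Big)^{p/2},\qquad K=\sqrt{2p^{-1}}\sqrt{\max(\tilde c_p,p/2)}.$$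
   Context: For a separable Banach space $(\mathbb B,|\cdot|_{\mathbb B})$ and $p\in[2,\infty[$, let $\psi_p(x)=|x|_{\mathbb B}^p$. $\mathbb B$ belongs to the class $\widetilde{\mathcal C}_2(p,\tilde c_p)$ if $\psi_p$ is twice differentiable and its second derivative satisfies $|D^2\psi_p(x)(u,v)|\le \tilde c_p|x|_{\mathbb B}^{p-2}|u|_{\mathbb B}|v|_{\mathbb B}$ for all $x,u,v\in\mathbb B$ (here $D^2\psi_p(x)(u,v)$ is the second derivative of $\psi_p$ at $x$ in directions $u,v$). *)

theory Defs
  imports "HOL-Probability.Probability"
begin

text \<open>Power with the convention 0^0 = 1 (needed for the factor |x|^(p-2) when p = 2).\<close>
definition pow0 :: "real \<Rightarrow> real \<Rightarrow> real" where
  "pow0 t a = (if a = 0 then 1 else t powr a)"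

definition class_C2 :: "real \<Rightarrow> real \<Rightarrow> 'b::real_normed_vector itself \<Rightarrow> bool" where
  "class_C2 p c (_::'b itself) \<longleftrightarrow>
     (\<exists>(D1 :: 'b \<Rightarrow> ('b \<Rightarrow>\<^sub>L real)) (D2 :: 'b \<Rightarrow> ('b \<Rightarrow>\<^sub>L ('b \<Rightarrow>\<^sub>L real))).
        (\<forall>x. ((\<lambda>y. norm y powr p) has_derivative blinfun_apply (D1 x)) (at x)) \<and>
        (\<forall>x. (D1 has_derivative blinfun_apply (D2 x)) (at x)) \<and>
        (\<forall>x u v. \<bar>blinfun_apply (blinfun_apply (D2 x) u) v\<bar>
                   \<le> c * pow0 (norm x) (p - 2) * norm u * norm v))"

definition cond_expB :: "'a measure \<Rightarrow> 'a measure \<Rightarrow> ('a \<Rightarrow> 'b::{banach,second_countable_topology}) \<Rightarrow> 'a \<Rightarrow> 'b" where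
  "cond_expB M F X = (SOME Y. Y \<in> borel_measurable F \<and> integrable M Y \<and>
      (\<forall>A\<in>sets F. (\<integral>x. indicator A x *\<^sub>R Y x \<partial>M) = (\<integral>x. indicator A x *\<^sub>R X x \<partial>M)))"

end

theory Submission
  imports Defs
begin

text \<open>
  Let \<open>\<psi>(x) = |x|\<^sup>p\<close> with gradient \<open>D\<close> and \<open>C = max c (p / 2)\<close>. Convexity gives \<open>\<psi>(S i) - \<psi>(S (i - 1)) \<le> D (S i) (X i)\<close>.
  Writing \<open>D (S i)\<close> as a telescoping sum and summing over \<open>i\<close> yields
  \<open>\<psi>(S n) \<le> \<Sum>j. (D (S j) - D (S (j - 1))) (X j + \<dots> + X n)\<close>, and the \<open>j\<close>-th term may be conditioned on \<open>F j\<close>.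
  Splitting the step from \<open>S (j - 1)\<close> to \<open>S j\<close> into \<open>N\<close> equal pieces, the second derivative bound and the conditional
  Hoelder inequality bound \<open>f m\<close>, the conditional expectation of \<open>\<psi>\<close> at the \<open>m\<close>-th grid point, by
  \<open>\<Sum>i<m. (C / N) b\<^sub>i (f i + O(1 / N)) powr (1 - 2 / p)\<close>, where \<open>b\<^sub>i\<close> is the \<open>b_{j,n}\<close> of the step \<open>j\<close> containing
  the piece \<open>i\<close>. A discrete Bihari inequality turns this into \<open>f (n N) powr (2 / p) \<le> (2 C / p) (\<Sum>j. b_{j,n}) + o(1)\<close>.
  Working on a grid rather than with integrals over the interpolation parameter avoids jointly measurable versions
  of conditional expectations.
\<close>

section \<open>Conditional expectation in Banach spaces\<close>

text \<open>The property from which \<open>cond_expB\<close> selects by \<open>SOME\<close>, kept as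
  a predicate so that candidates can be checked before existence is known.\<close>

definition is_cond_expB :: "'a measure \<Rightarrow> 'a measure \<Rightarrow> ('a \<Rightarrow> 'b::{banach,second_countable_topology}) \<Rightarrow> ('a \<Rightarrow> 'b) \<Rightarrow> bool" where
  "is_cond_expB M F X Y \<longleftrightarrow> Y \<in> borel_measurable F \<and> integrable M Y \<and>
     (\<forall>A\<in>sets F. (\<integral>x. indicator A x *\<^sub>R Y x \<partial>M) = (\<integral>x. indicator A x *\<^sub>R X x \<partial>M))"

lemma is_cond_expB_lincomb:
  assumes sub: "subalgebra M F" and "integrable M X" "integrable M X'"
    and h: "is_cond_expB M F X Y" and h': "is_cond_expB M F X' Y'"
  shows "is_cond_expB M F (\<lambda>x. X x + a *\<^sub>R X' x) (\<lambda>x. Y x + a *\<^sub>R Y' x)"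
proof -
  have "integrable M (\<lambda>x. indicator A x *\<^sub>R Z x)" if "integrable M Z" "A \<in> sets F" for A and Z :: "'a \<Rightarrow> 'b"
    using that sub by (intro integrable_mult_indicator) (auto simp: subalgebra_def)
  moreover have "(\<lambda>x. indicator A x *\<^sub>R (Z x + a *\<^sub>R Z' x)) = (\<lambda>x. indicator A x *\<^sub>R Z x + a *\<^sub>R (indicator A x *\<^sub>R Z' x))"
    for A :: "'a set" and Z Z' :: "'a \<Rightarrow> 'b" by (simp add: algebra_simps)
  ultimately show ?thesis using assms unfolding is_cond_expB_def
    by (auto simp del: scaleR_scaleR)
qed

text \<open>Norm and integral commute for a constant vector. \<open>Y\<close> is approximated by
  \<open>F\<close>-measurable simple functions \<open>y i\<close>, and the defining identity is
  tested on the level sets of \<open>y i\<close> inside \<open>A\<close>. The error is the integral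
  of \<open>norm (y i x - Y x)\<close>, which tends to 0.\<close>

lemma (in prob_space) is_cond_expB_norm_integral_le:
  assumes sub: "subalgebra M F" and X: "integrable M X" and h: "is_cond_expB M F X Y" and A: "A \<in> sets F"
  shows "(\<integral>x. indicator A x *\<^sub>R norm (Y x) \<partial>M) \<le> (\<integral>x. indicator A x *\<^sub>R norm (X x) \<partial>M)"
proof -
  have Y: "integrable M Y" "Y \<in> borel_measurable F" using h by (auto simp: is_cond_expB_def)
  have FM: "\<And>A. A \<in> sets F \<Longrightarrow> A \<in> sets M" and sp: "space F = space M"
    using sub by (auto simp: subalgebra_def)
  note [measurable] = FM[OF A]
  obtain y where y: "\<And>i. simple_function F (y i)" "\<And>x. x \<in> space M \<Longrightarrow> (\<lambda>i. y i x) \<longlonglongrightarrow> Y x"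
    "\<And>i x. x \<in> space M \<Longrightarrow> norm (y i x) \<le> 2 * norm (Y x)"
    using borel_measurable_implies_sequence_metric[OF Y(2), of 0]
    unfolding sp dist_norm diff_0_right by blast
  have ym[measurable]: "y i \<in> borel_measurable M" for i
    using y(1) sub measurable_from_subalg borel_measurable_simple_function by blast
  have yint: "integrable M (y i)" for i
    by (rule Bochner_Integration.integrable_bound[of _ "\<lambda>x. 2 * norm (Y x)"]) (use Y y in auto)
  have ind: "integrable M (\<lambda>x. indicator B x *\<^sub>R Z x)" if "integrable M Z" "B \<in> sets F"
    for B and Z :: "'a \<Rightarrow> 'c::{banach,second_countable_topology}"
    using that FM by (intro integrable_mult_indicator) auto
  have step: "(\<integral>x. indicator A x *\<^sub>R norm (y i x) \<partial>M) \<le>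
      (\<integral>x. indicator A x *\<^sub>R norm (X x) \<partial>M) + (\<integral>x. indicator A x *\<^sub>R norm (y i x - Y x) \<partial>M)" for i
  proof -
    let ?V = "y i ` space M"
    define B where "B v = A \<inter> (y i -` {v} \<inter> space M)" for v
    have fin: "finite ?V" using y(1)[of i] sp by (auto simp: simple_function_def)
    have B: "B v \<in> sets F" for v
      unfolding B_def using simple_functionD(2)[OF y(1)[of i], of "{v}"] A sp by auto
    have split: "(\<integral>x. indicator A x *\<^sub>R Z x \<partial>M) = (\<Sum>v\<in>?V. (\<integral>x. indicator (B v) x *\<^sub>R Z x \<partial>M))"
      if "integrable M Z" for Z :: "'a \<Rightarrow> real"
    proof -
      have "(\<integral>x. indicator A x *\<^sub>R Z x \<partial>M) = (\<integral>x. (\<Sum>v\<in>?V. indicator (B v) x *\<^sub>R Z x) \<partial>M)"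
      proof (rule Bochner_Integration.integral_cong)
        fix x assume x: "x \<in> space M"
        have "(\<Sum>v\<in>?V. indicator (B v) x *\<^sub>R Z x) = (\<Sum>v\<in>?V. if v = y i x then indicator A x *\<^sub>R Z x else 0)"
          using x by (intro sum.cong) (auto simp: B_def indicator_def)
        also have "\<dots> = indicator A x *\<^sub>R Z x" using x fin by simp
        finally show "indicator A x *\<^sub>R Z x = (\<Sum>v\<in>?V. indicator (B v) x *\<^sub>R Z x)" by (rule sym)
      qed simp
      also have "\<dots> = (\<Sum>v\<in>?V. (\<integral>x. indicator (B v) x *\<^sub>R Z x \<partial>M))"
        using ind[OF that B] by (intro Bochner_Integration.integral_sum) auto
      finally show ?thesis .
    qed
    have "(\<integral>x. indicator (B v) x *\<^sub>R norm (y i x) \<partial>M) \<le>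
      (\<integral>x. indicator (B v) x *\<^sub>R norm (X x) \<partial>M) + (\<integral>x. indicator (B v) x *\<^sub>R norm (y i x - Y x) \<partial>M)" for v
    proof -
      have "(\<integral>x. indicator (B v) x *\<^sub>R norm (y i x) \<partial>M) = (\<integral>x. indicator (B v) x *\<^sub>R norm v \<partial>M)"
        by (intro Bochner_Integration.integral_cong) (auto simp: B_def indicator_def)
      also have "\<dots> = norm (\<integral>x. indicator (B v) x *\<^sub>R v \<partial>M)"
        using FM[OF B] by (subst (1 2) integral_scaleR_left) (auto simp: integrable_indicator_iff emeasure_eq_measure)
      also have "(\<integral>x. indicator (B v) x *\<^sub>R v \<partial>M) = (\<integral>x. indicator (B v) x *\<^sub>R y i x \<partial>M)"
        by (intro Bochner_Integration.integral_cong) (auto simp: B_def indicator_def)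
      also have "\<dots> = (\<integral>x. indicator (B v) x *\<^sub>R X x \<partial>M) + (\<integral>x. indicator (B v) x *\<^sub>R (y i x - Y x) \<partial>M)"
        using h B ind[OF yint[of i] B[of v]] ind[OF Y(1) B[of v]] by (simp add: is_cond_expB_def algebra_simps)
      also have "norm \<dots> \<le> norm (\<integral>x. indicator (B v) x *\<^sub>R X x \<partial>M) + norm (\<integral>x. indicator (B v) x *\<^sub>R (y i x - Y x) \<partial>M)"
        by (rule norm_triangle_ineq)
      also have "\<dots> \<le> (\<integral>x. norm (indicator (B v) x *\<^sub>R X x) \<partial>M) + (\<integral>x. norm (indicator (B v) x *\<^sub>R (y i x - Y x)) \<partial>M)"
        by (intro add_mono integral_norm_bound)
      finally show ?thesis by simp
    qed
    from sum_mono[OF this, of "\<lambda>v. v" ?V] show ?thesis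
      using yint[of i] X Y by (subst (1 2 3) split) (auto simp: sum.distrib)
  qed
  have l1: "(\<lambda>i. (\<integral>x. indicator A x *\<^sub>R norm (y i x) \<partial>M)) \<longlonglongrightarrow> (\<integral>x. indicator A x *\<^sub>R norm (Y x) \<partial>M)"
  proof (rule integral_dominated_convergence[where w = "\<lambda>x. 2 * norm (Y x)"])
    show "AE x in M. (\<lambda>i. indicator A x *\<^sub>R norm (y i x)) \<longlonglongrightarrow> indicator A x *\<^sub>R norm (Y x)"
      using y(2) by (auto intro!: tendsto_intros)
  qed (use Y y(3) in \<open>auto simp: indicator_def\<close>)
  have l2: "(\<lambda>i. (\<integral>x. indicator A x *\<^sub>R norm (y i x - Y x) \<partial>M)) \<longlonglongrightarrow> (\<integral>x. 0 \<partial>M)"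
  \<comment> \<open>The constant 3 is 2 + 1, from \<open>norm (y i x) \<le> 2 * norm (Y x)\<close>
    and the triangle inequality.\<close>
  proof (rule integral_dominated_convergence[where w = "\<lambda>x. 3 * norm (Y x)"])
    show "AE x in M. (\<lambda>i. indicator A x *\<^sub>R norm (y i x - Y x)) \<longlonglongrightarrow> 0"
      using y(2) by (auto intro!: AE_I2 tendsto_mult_right_zero tendsto_norm_zero LIM_zero)
    have "norm (y i x - Y x) \<le> 3 * norm (Y x)" if "x \<in> space M" for i x
      using y(3)[OF that, of i] norm_triangle_ineq4[of "y i x" "Y x"] by linarith
    then show "AE x in M. norm (indicator A x *\<^sub>R norm (y i x - Y x)) \<le> 3 * norm (Y x)" for i
      by (auto simp: indicator_def)
  qed (use Y in auto)
  have "(\<integral>x. indicator A x *\<^sub>R norm (Y x) \<partial>M) \<le> (\<integral>x. indicator A x *\<^sub>R norm (X x) \<partial>M) + (\<integral>x. 0 \<partial>M)"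
    by (rule LIMSEQ_le[OF l1 tendsto_add[OF tendsto_const l2]]) (use step in auto)
  then show ?thesis by simp
qed

text \<open>By the preceding contraction in mean, the increments of \<open>Y i\<close> inherit the
  geometric rate of \<open>s i\<close>. Their norms are therefore summable almost everywhere with
  integrable sum, so \<open>Y i\<close> converges almost everywhere under a dominating function, and
  the defining identity passes to the limit.\<close>

lemma (in prob_space) is_cond_expB_limit:
  assumes sub: "subalgebra M F" and f: "integrable M f" and s: "\<And>i. integrable M (s i)"
    and h: "\<And>i. is_cond_expB M F (s i) (Y i)"
    and close: "\<And>i. (\<integral>x. norm (s i x - f x) \<partial>M) \<le> (1/2)^i"
  shows "is_cond_expB M F f (\<lambda>x. lim (\<lambda>i. Y i x))"
proof -
  have FM: "\<And>A. A \<in> sets F \<Longrightarrow> A \<in> sets M" and sp: "space F = space M"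
    using sub by (auto simp: subalgebra_def)
  have Y: "integrable M (Y i)" "Y i \<in> borel_measurable F" for i using h by (auto simp: is_cond_expB_def)
  let ?Z = "\<lambda>i x. Y (Suc i) x - Y i x"
  have Zi: "integrable M (?Z i)" for i using Y by auto
  have Zb: "(\<integral>x. norm (?Z i x) \<partial>M) \<le> 2 * (1/2)^i" for i
  proof -
    have c: "is_cond_expB M F (\<lambda>x. s (Suc i) x - s i x) (?Z i)"
      using is_cond_expB_lincomb[OF sub s s h h, of "Suc i" "-1" i] by simp
    have "(\<integral>x. norm (?Z i x) \<partial>M) = (\<integral>x. indicator (space F) x *\<^sub>R norm (?Z i x) \<partial>M)"
      by (intro Bochner_Integration.integral_cong) (auto simp: sp)
    also have "\<dots> \<le> (\<integral>x. indicator (space F) x *\<^sub>R norm (s (Suc i) x - s i x) \<partial>M)"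
      by (rule is_cond_expB_norm_integral_le[OF sub _ c]) (use s in auto)
    also have "\<dots> = (\<integral>x. norm (s (Suc i) x - s i x) \<partial>M)"
      by (intro Bochner_Integration.integral_cong) (auto simp: sp)
    also have "\<dots> \<le> (\<integral>x. norm (s (Suc i) x - f x) + norm (s i x - f x) \<partial>M)"
      by (intro integral_mono) (use s f in \<open>auto intro: norm_triangle_le_diff\<close>, metis dist_norm dist_triangle2)
    also have "\<dots> \<le> (1/2)^Suc i + (1/2)^i"
      using s f by (subst Bochner_Integration.integral_add) (auto intro!: add_mono close simp del: power_Suc)
    also have "\<dots> \<le> 2 * (1/2)^i" by simp
    finally show ?thesis .
  qed
  have sm: "summable (\<lambda>i. (\<integral>x. norm (?Z i x) \<partial>M))"
    by (rule summable_comparison_test'[of "\<lambda>i. 2 * (1/2::real)^i" 0])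
      (use Zb in \<open>auto intro!: summable_mult summable_geometric\<close>)
  have AEs: "AE x in M. summable (\<lambda>i. norm (?Z i x))"
  proof -
    have "(\<integral>\<^sup>+x. (\<Sum>i. ennreal (norm (?Z i x))) \<partial>M) = (\<Sum>i. (\<integral>\<^sup>+x. ennreal (norm (?Z i x)) \<partial>M))"
      using Zi by (intro nn_integral_suminf) auto
    also have "\<dots> = (\<Sum>i. ennreal (\<integral>x. norm (?Z i x) \<partial>M))"
      using Zi by (subst nn_integral_eq_integral) auto
    also have "\<dots> = ennreal (\<Sum>i. (\<integral>x. norm (?Z i x) \<partial>M))"
      using sm by (intro suminf_ennreal2) auto
    finally have "(\<integral>\<^sup>+x. (\<Sum>i. ennreal (norm (?Z i x))) \<partial>M) \<noteq> \<infinity>" by simp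
    then have "AE x in M. (\<Sum>i. ennreal (norm (?Z i x))) \<noteq> \<infinity>"
      using Zi by (intro nn_integral_PInf_AE) auto
    then show ?thesis by eventually_elim (auto intro!: summable_suminf_not_top)
  qed
  \<comment> \<open>The initial term plus the sum of all increment norms dominates every
    \<open>Y i\<close>; it serves both for integrability of the limit and for convergence of the
    integrals over \<open>A\<close>.\<close>
  define w where "w x = norm (Y 0 x) + (\<Sum>i. norm (?Z i x))" for x
  have w: "integrable M w"
    unfolding w_def using Y(1) Zi sm AEs
    by (intro Bochner_Integration.integrable_add integrable_norm integrable_suminf) auto
  let ?Y = "\<lambda>x. lim (\<lambda>i. Y i x)"
  have tel: "Y i x = Y 0 x + (\<Sum>k<i. ?Z k x)" for i x by (induct i) auto
  have lim: "AE x in M. (\<lambda>i. Y i x) \<longlonglongrightarrow> ?Y x"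
    using AEs
  proof eventually_elim
    case (elim x)
    have "summable (\<lambda>i. ?Z i x)" using elim by (rule summable_norm_cancel)
    then have "(\<lambda>i. Y 0 x + (\<Sum>k<i. ?Z k x)) \<longlonglongrightarrow> Y 0 x + suminf (\<lambda>i. ?Z i x)"
      by (intro tendsto_add[OF tendsto_const] summable_LIMSEQ)
    then have "convergent (\<lambda>i. Y i x)" unfolding tel[symmetric] by (rule convergentI)
    then show ?case by (simp add: convergent_LIMSEQ_iff)
  qed
  have bd: "AE x in M. norm (Y i x) \<le> w x" for i
    using AEs
  proof eventually_elim
    case (elim x)
    have "norm (Y i x) \<le> norm (Y 0 x) + norm (\<Sum>k<i. ?Z k x)"
      using tel[of i x] norm_triangle_ineq by metis
    also have "norm (\<Sum>k<i. ?Z k x) \<le> (\<Sum>k<i. norm (?Z k x))" by (rule norm_sum)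
    also have "\<dots> \<le> (\<Sum>k. norm (?Z k x))" using elim by (intro sum_le_suminf) auto
    finally show ?case by (simp add: w_def)
  qed
  \<comment> \<open>\<open>lim\<close> is measurable on the whole space, also at points of
    divergence, so no exceptional null set has to be removed.\<close>
  have YF: "?Y \<in> borel_measurable F" using Y(2) by measurable
  then have YM: "?Y \<in> borel_measurable M" by (rule measurable_from_subalg[OF sub])
  have Yi: "integrable M ?Y"
    by (rule integrable_dominated_convergence[OF YM _ w lim bd]) (use Y(1) in auto)
  have "(\<integral>x. indicator A x *\<^sub>R ?Y x \<partial>M) = (\<integral>x. indicator A x *\<^sub>R f x \<partial>M)" if A: "A \<in> sets F" for A
  proof -
    note [measurable] = FM[OF A] YM
    have 1: "(\<lambda>i. (\<integral>x. indicator A x *\<^sub>R Y i x \<partial>M)) \<longlonglongrightarrow> (\<integral>x. indicator A x *\<^sub>R ?Y x \<partial>M)"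
    proof (rule integral_dominated_convergence[where w=w])
      show "AE x in M. (\<lambda>i. indicator A x *\<^sub>R Y i x) \<longlonglongrightarrow> indicator A x *\<^sub>R ?Y x"
        using lim by eventually_elim (auto intro!: tendsto_intros)
      show "AE x in M. norm (indicator A x *\<^sub>R Y i x) \<le> w x" for i
        using bd[of i] by eventually_elim (auto simp: indicator_def intro: order_trans[OF norm_ge_zero])
    qed (use Y(1) w in auto)
    have "norm ((\<integral>x. indicator A x *\<^sub>R Y i x \<partial>M) - (\<integral>x. indicator A x *\<^sub>R f x \<partial>M)) \<le> (1/2)^i" for i
    proof -
      have "(\<integral>x. indicator A x *\<^sub>R Y i x \<partial>M) - (\<integral>x. indicator A x *\<^sub>R f x \<partial>M)
          = (\<integral>x. indicator A x *\<^sub>R (s i x - f x) \<partial>M)"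
        using h[of i] A s[of i] f integrable_mult_indicator[OF FM[OF A] s[of i]] integrable_mult_indicator[OF FM[OF A] f]
        by (auto simp: is_cond_expB_def scaleR_diff_right)
      also have "norm \<dots> \<le> (\<integral>x. norm (indicator A x *\<^sub>R (s i x - f x)) \<partial>M)" by (rule integral_norm_bound)
      also have "\<dots> \<le> (\<integral>x. norm (s i x - f x) \<partial>M)"
        using integrable_mult_indicator[OF FM[OF A], of "\<lambda>x. s i x - f x"] s f
        by (intro integral_mono integrable_norm) (auto simp: indicator_def)
      finally show ?thesis using close[of i] by simp
    qed
    then have "(\<lambda>i. (\<integral>x. indicator A x *\<^sub>R Y i x \<partial>M) - (\<integral>x. indicator A x *\<^sub>R f x \<partial>M)) \<longlonglongrightarrow> 0"
      by (intro Lim_null_comparison[OF _ LIMSEQ_power_zero[of "1/2::real"]] always_eventually) auto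
    then have "(\<lambda>i. (\<integral>x. indicator A x *\<^sub>R Y i x \<partial>M)) \<longlonglongrightarrow> (\<integral>x. indicator A x *\<^sub>R f x \<partial>M)"
      by (simp add: LIM_zero_iff)
    then show ?thesis using 1 LIMSEQ_unique by blast
  qed
  then show ?thesis using YF Yi by (simp add: is_cond_expB_def)
qed

text \<open>Induction over Bochner integrable functions. For an indicator times a vector
  \<open>c\<close>, the scalar conditional expectation times \<open>c\<close> works; sums follow by
  linearity and limits from \<open>is_cond_expB_limit\<close>.\<close>

lemma (in prob_space) is_cond_expB_exists:
  fixes X :: "'a \<Rightarrow> 'b::{banach,second_countable_topology}"
  assumes sub: "subalgebra M F" and "integrable M X"
  shows "\<exists>Y. is_cond_expB M F X Y"
  using assms(2)
proof induct
  case (base A c)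
  interpret finite_measure_subalgebra M F by unfold_locales (rule sub)
  let ?g = "real_cond_exp M F (indicator A)"
  have A: "integrable M (indicator A :: 'a \<Rightarrow> real)" using base by (auto simp: integrable_indicator_iff)
  have "(\<integral>x. indicator B x *\<^sub>R (?g x *\<^sub>R c) \<partial>M) = (\<integral>x. indicator B x *\<^sub>R (indicator A x *\<^sub>R c) \<partial>M)"
    if B: "B \<in> sets F" for B
  proof -
    have BM: "B \<in> sets M" using B sub by (auto simp: subalgebra_def)
    have "(\<integral>x. indicator B x *\<^sub>R ?g x \<partial>M) = (\<integral>x. indicator B x *\<^sub>R indicator A x \<partial>M)"
      using real_cond_exp_intA[OF A B] by (simp add: set_lebesgue_integral_def)
    moreover have "integrable M (\<lambda>x. indicator B x *\<^sub>R ?g x)" "integrable M (\<lambda>x. indicator B x *\<^sub>R (indicator A x::real))"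
      by (rule integrable_mult_indicator[OF BM real_cond_exp_int(1)[OF A]], rule integrable_mult_indicator[OF BM A])
    ultimately show ?thesis
      by (simp add: integral_scaleR_left)
  qed
  then have "is_cond_expB M F (\<lambda>x. indicator A x *\<^sub>R c) (\<lambda>x. ?g x *\<^sub>R c)"
    using real_cond_exp_int(1)[OF A] by (auto simp: is_cond_expB_def)
  then show ?case by blast
next
  case (add f g)
  then show ?case using is_cond_expB_lincomb[OF sub, of f g _ _ 1] by fastforce
next
  case (lim f s)
  from lim(2) obtain Y where Y: "\<And>i. is_cond_expB M F (s i) (Y i)" by metis
  have *: "(\<lambda>i. (\<integral>x. norm (s i x - f x) \<partial>M)) \<longlonglongrightarrow> (\<integral>x. 0 \<partial>M)"
  proof (rule integral_dominated_convergence[where w = "\<lambda>x. 3 * norm (f x)"])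
    show "AE x in M. (\<lambda>i. norm (s i x - f x)) \<longlonglongrightarrow> 0"
      using lim(3) by (auto intro!: AE_I2 tendsto_norm_zero LIM_zero)
    have "norm (s i x - f x) \<le> 3 * norm (f x)" if "x \<in> space M" for i x
      using lim(4)[OF that, of i] norm_triangle_ineq4[of "s i x" "f x"] by linarith
    then show "AE x in M. norm (norm (s i x - f x)) \<le> 3 * norm (f x)" for i by auto
  qed (use lim in auto)
  \<comment> \<open>Convergence in mean comes without a rate, so a subsequence is chosen that meets
    the geometric one.\<close>
  have "\<exists>r. (\<integral>x. norm (s r x - f x) \<partial>M) \<le> (1/2)^i" for i
  proof -
    have "\<forall>\<^sub>F r in sequentially. (\<integral>x. norm (s r x - f x) \<partial>M) < (1/2)^i"
      using * by (rule order_tendstoD(2)) simp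
    then show ?thesis by (metis (no_types, lifting) eventually_sequentially less_imp_le order_refl)
  qed
  then obtain r where "\<And>i. (\<integral>x. norm (s (r i) x - f x) \<partial>M) \<le> (1/2)^i" by metis
  from is_cond_expB_limit[OF sub lim(5) lim(1) Y this] show ?case by blast
qed

text \<open>Existence makes the choice by \<open>SOME\<close> meaningful; from here on
  \<open>cond_expB\<close> enters only through this property.\<close>

lemma (in prob_space) cond_expB_is_cond_expB:
  assumes "subalgebra M F" and "integrable M X"
  shows "is_cond_expB M F X (cond_expB M F X)"
  using someI_ex[OF is_cond_expB_exists[OF assms]] unfolding is_cond_expB_def cond_expB_def .

section \<open>Convexity of powers of the norm\<close>

lemma powr_convex_nonneg:
  fixes p a b t :: real
  assumes "p \<ge> 1" "0 \<le> a" "0 \<le> b" "0 \<le> t" "t \<le> 1"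
  shows "((1 - t) * a + t * b) powr p \<le> (1 - t) * a powr p + t * b powr p"
proof (cases "a = 0 \<or> b = 0")
  case True
  \<comment> \<open>With one endpoint zero only a scaling remains, and
    \<open>s powr p \<le> s\<close> on the unit interval suffices.\<close>
  have "(s * c) powr p \<le> s * c powr p" if "0 \<le> s" "s \<le> 1" "0 \<le> c" for s c :: real
  proof -
    have "s powr p \<le> s powr 1" using that assms by (intro powr_mono') auto
    then show ?thesis using that by (simp add: powr_mult mult_right_mono)
  qed
  from this[of "1 - t" a] this[of t b] True show ?thesis using assms by auto
next
  case False
  then show ?thesis
    using powr_convex[OF assms(1)] assms by (auto dest!: convex_onD[of _ _ t a b])
qed

lemma convex_on_norm_powr:
  fixes p :: real
  assumes "p \<ge> 1"
  shows "convex_on UNIV (\<lambda>x::'b::real_normed_vector. norm x powr p)"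
proof (rule convex_onI)
  fix t :: real and x y :: 'b assume t: "0 < t" "t < 1"
  have "norm ((1 - t) *\<^sub>R x + t *\<^sub>R y) powr p \<le> ((1 - t) * norm x + t * norm y) powr p"
    using t assms norm_triangle_ineq[of "(1 - t) *\<^sub>R x" "t *\<^sub>R y"] by (intro powr_mono2) auto
  also have "\<dots> \<le> (1 - t) * norm x powr p + t * norm y powr p"
    using t assms by (intro powr_convex_nonneg) auto
  finally show "norm ((1 - t) *\<^sub>R x + t *\<^sub>R y) powr p \<le> (1 - t) * norm x powr p + t * norm y powr p" .
qed simp

section \<open>Sums, norm bounds and pull-out for conditional expectations\<close>

lemma (in prob_space) is_cond_expB_sum:
  fixes X :: "'i \<Rightarrow> 'a \<Rightarrow> 'b::{banach,second_countable_topology}"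
  assumes sub: "subalgebra M F" and "finite I"
    and "\<And>i. i \<in> I \<Longrightarrow> integrable M (X i)" "\<And>i. i \<in> I \<Longrightarrow> is_cond_expB M F (X i) (Y i)"
  shows "is_cond_expB M F (\<lambda>x. \<Sum>i\<in>I. X i x) (\<lambda>x. \<Sum>i\<in>I. Y i x)"
  using assms(2,3,4)
proof (induct I)
  case empty then show ?case by (simp add: is_cond_expB_def)
next
  case (insert i I)
  have "is_cond_expB M F (\<lambda>x. X i x + 1 *\<^sub>R (\<Sum>i\<in>I. X i x)) (\<lambda>x. Y i x + 1 *\<^sub>R (\<Sum>i\<in>I. Y i x))"
    using insert by (intro is_cond_expB_lincomb sub) auto
  then show ?case using insert by simp
qed

text \<open>The set \<open>A\<close> where the inequality fails lies in \<open>F\<close>, since both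
  sides are \<open>F\<close>-measurable. Integrated over \<open>A\<close>, the positive excess is at
  most 0, hence \<open>A\<close> is null.\<close>

lemma (in prob_space) is_cond_expB_norm_le:
  assumes sub: "subalgebra M F" and X: "integrable M X" and h: "is_cond_expB M F X Y"
  shows "AE x in M. norm (Y x) \<le> real_cond_exp M F (\<lambda>x. norm (X x)) x"
proof -
  interpret finite_measure_subalgebra M F by unfold_locales (rule sub)
  let ?h = "real_cond_exp M F (\<lambda>x. norm (X x))"
  have Y: "integrable M Y" and [measurable]: "Y \<in> borel_measurable F" using h by (auto simp: is_cond_expB_def)
  have hi: "integrable M ?h" using X by (intro real_cond_exp_int) auto
  define A where "A = {x \<in> space F. ?h x < norm (Y x)}"
  have A: "A \<in> sets F" unfolding A_def by measurable
  then have AM: "A \<in> sets M" and sp: "space F = space M" using sub by (auto simp: subalgebra_def)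
  have i1: "integrable M (\<lambda>x. indicator A x *\<^sub>R norm (Y x))" "integrable M (\<lambda>x. indicator A x *\<^sub>R ?h x)"
    by (rule integrable_mult_indicator[OF AM integrable_norm[OF Y]], rule integrable_mult_indicator[OF AM hi])
  have "(\<integral>x. indicator A x *\<^sub>R norm (Y x) \<partial>M) \<le> (\<integral>x. indicator A x *\<^sub>R ?h x \<partial>M)"
    using is_cond_expB_norm_integral_le[OF sub X h A] real_cond_exp_intA[OF integrable_norm[OF X] A]
    by (simp add: set_lebesgue_integral_def)
  moreover have nn: "AE x in M. 0 \<le> indicator A x *\<^sub>R norm (Y x) - indicator A x *\<^sub>R ?h x"
    by (auto simp: A_def indicator_def)
  moreover have i2: "integrable M (\<lambda>x. indicator A x *\<^sub>R norm (Y x) - indicator A x *\<^sub>R ?h x)"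
    using i1 by auto
  moreover have "0 \<le> (\<integral>x. indicator A x *\<^sub>R norm (Y x) - indicator A x *\<^sub>R ?h x \<partial>M)"
    by (rule integral_nonneg_AE[OF nn])
  ultimately have "(\<integral>x. indicator A x *\<^sub>R norm (Y x) - indicator A x *\<^sub>R ?h x \<partial>M) = 0"
    using i1 by auto
  then have "AE x in M. indicator A x *\<^sub>R norm (Y x) - indicator A x *\<^sub>R ?h x = 0"
    using integral_nonneg_eq_0_iff_AE[OF i2 nn] by simp
  then show ?thesis using AE_space
    by eventually_elim (auto simp: A_def indicator_def sp split: if_splits)
qed

text \<open>Conditional Jensen for the scalar function \<open>norm (X x)\<close> bounds
  \<open>norm (Y x) powr p\<close> by an integrable conditional expectation.\<close>

lemma (in prob_space) integrable_norm_powr_cond_expB: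
  fixes p :: real
  assumes sub: "subalgebra M F" and X: "integrable M X" and h: "is_cond_expB M F X Y"
    and p: "p \<ge> 1" and Xp: "integrable M (\<lambda>x. norm (X x) powr p)"
  shows "integrable M (\<lambda>x. norm (Y x) powr p)"
proof -
  interpret finite_measure_subalgebra M F by unfold_locales (rule sub)
  have [measurable]: "Y \<in> borel_measurable M" using h by (auto simp: is_cond_expB_def)
  have "AE x in M. \<bar>real_cond_exp M F (\<lambda>x. norm (X x)) x\<bar> powr p \<le> real_cond_exp M F (\<lambda>x. \<bar>norm (X x)\<bar> powr p) x"
    using convex_on_norm_powr[OF p, where 'b=real] X Xp
    by (intro real_cond_exp_jensens_inequality(2)[where I=UNIV]) auto
  with is_cond_expB_norm_le[OF sub X h]
  have "AE x in M. norm (norm (Y x) powr p) \<le> real_cond_exp M F (\<lambda>x. norm (X x) powr p) x"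
  proof eventually_elim
    case (elim x)
    have "norm (Y x) powr p \<le> \<bar>real_cond_exp M F (\<lambda>x. norm (X x)) x\<bar> powr p"
      using elim p by (intro powr_mono2) auto
    then show ?case using elim by simp
  qed
  then show ?thesis
    by (intro Bochner_Integration.integrable_bound[OF real_cond_exp_int(1)[OF Xp]])
      (auto elim: eventually_mono intro: order_trans)
qed

text \<open>On each of the finitely many level sets of \<open>s\<close> the functional
  \<open>H (s x)\<close> is a fixed bounded one and commutes with the Bochner integral.\<close>

lemma (in prob_space) is_cond_expB_pull_out_simple:
  fixes X :: "'a \<Rightarrow> 'b::{banach,second_countable_topology}" and H :: "'c \<Rightarrow> 'b \<Rightarrow>\<^sub>L real"
  assumes sub: "subalgebra M F" and X: "integrable M X" and h: "is_cond_expB M F X Y"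
    and s: "simple_function F s" and A: "A \<in> sets F"
  shows "(\<integral>x. indicator A x *\<^sub>R H (s x) (X x) \<partial>M) = (\<integral>x. indicator A x *\<^sub>R H (s x) (Y x) \<partial>M)"
proof -
  have Y: "integrable M Y" using h by (auto simp: is_cond_expB_def)
  have FM: "\<And>A. A \<in> sets F \<Longrightarrow> A \<in> sets M" and sp: "space F = space M"
    using sub by (auto simp: subalgebra_def)
  let ?V = "s ` space M"
  define B where "B v = A \<inter> (s -` {v} \<inter> space M)" for v
  have fin: "finite ?V" using s sp by (auto simp: simple_function_def)
  have B: "B v \<in> sets F" for v
    unfolding B_def using simple_functionD(2)[OF s, of "{v}"] A sp by auto
  have split: "(\<integral>x. indicator A x *\<^sub>R H (s x) (Z x) \<partial>M) = (\<Sum>v\<in>?V. H v (\<integral>x. indicator (B v) x *\<^sub>R Z x \<partial>M))"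
    if Z: "integrable M Z" for Z
  proof -
    have i: "integrable M (\<lambda>x. indicator (B v) x *\<^sub>R Z x)" for v
      using integrable_mult_indicator[OF FM[OF B] Z] .
    have "(\<integral>x. indicator A x *\<^sub>R H (s x) (Z x) \<partial>M) = (\<integral>x. (\<Sum>v\<in>?V. H v (indicator (B v) x *\<^sub>R Z x)) \<partial>M)"
    proof (rule Bochner_Integration.integral_cong)
      fix x assume x: "x \<in> space M"
      have "(\<Sum>v\<in>?V. H v (indicator (B v) x *\<^sub>R Z x)) = (\<Sum>v\<in>?V. if v = s x then indicator A x *\<^sub>R H (s x) (Z x) else 0)"
        using x by (intro sum.cong) (auto simp: B_def indicator_def blinfun.zero_right)
      also have "\<dots> = indicator A x *\<^sub>R H (s x) (Z x)" using x fin by simp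
      finally show "indicator A x *\<^sub>R H (s x) (Z x) = (\<Sum>v\<in>?V. H v (indicator (B v) x *\<^sub>R Z x))" by (rule sym)
    qed simp
    also have "\<dots> = (\<Sum>v\<in>?V. (\<integral>x. H v (indicator (B v) x *\<^sub>R Z x) \<partial>M))"
      by (intro Bochner_Integration.integral_sum integrable_bounded_linear[OF blinfun.bounded_linear_right i])
    also have "\<dots> = (\<Sum>v\<in>?V. H v (\<integral>x. indicator (B v) x *\<^sub>R Z x \<partial>M))"
      by (intro sum.cong refl integral_bounded_linear[OF blinfun.bounded_linear_right i])
    finally show ?thesis .
  qed
  show ?thesis
    unfolding split[OF X] split[OF Y] using h B by (simp add: is_cond_expB_def)
qed

text \<open>Simple approximations of \<open>a\<close> with norm at most
  \<open>2 * norm (a x)\<close> reduce this to the simple case. The growth bound on \<open>H\<close>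
  supplies the dominating function, so \<open>H\<close> may be unbounded, as the gradient of \<psi>
  is.\<close>

lemma (in prob_space) is_cond_expB_pull_out:
  fixes X :: "'a \<Rightarrow> 'b::{banach,second_countable_topology}"
    and H :: "'c::{real_normed_vector,second_countable_topology} \<Rightarrow> 'b \<Rightarrow>\<^sub>L real"
  assumes sub: "subalgebra M F" and X: "integrable M X" and h: "is_cond_expB M F X Y"
    and a: "a \<in> borel_measurable F" and A: "A \<in> sets F"
    and H: "continuous_on UNIV H" and bound: "\<And>z. norm (H z) \<le> K * norm z powr r" and "0 \<le> r" "0 \<le> K"
    and i: "integrable M (\<lambda>x. norm (a x) powr r * norm (X x))" "integrable M (\<lambda>x. norm (a x) powr r * norm (Y x))"
  shows "(\<integral>x. indicator A x *\<^sub>R H (a x) (X x) \<partial>M) = (\<integral>x. indicator A x *\<^sub>R H (a x) (Y x) \<partial>M)"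
proof -
  have Y: "integrable M Y" using h by (auto simp: is_cond_expB_def)
  have FM: "\<And>A. A \<in> sets F \<Longrightarrow> A \<in> sets M" and sp: "space F = space M"
    using sub by (auto simp: subalgebra_def)
  note [measurable] = FM[OF A] measurable_from_subalg[OF sub a]
  obtain s where s: "\<And>i. simple_function F (s i)" "\<And>x. x \<in> space M \<Longrightarrow> (\<lambda>i. s i x) \<longlonglongrightarrow> a x"
    "\<And>i x. x \<in> space M \<Longrightarrow> norm (s i x) \<le> 2 * norm (a x)"
    using borel_measurable_implies_sequence_metric[OF a, of 0]
    unfolding sp dist_norm diff_0_right by blast
  have sm[measurable]: "s i \<in> borel_measurable M" for i
    using s(1) sub measurable_from_subalg borel_measurable_simple_function by blast
  \<comment> \<open>Evaluation is jointly continuous, so measurability of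
    \<open>H (f x) (Z x)\<close> reduces to that of the pair.\<close>
  have cont: "continuous_on UNIV (\<lambda>z. H (fst z) (snd z))"
    by (intro continuous_intros continuous_on_compose2[OF H]) auto
  have meas: "(\<lambda>x. H (f x) (Z x)) \<in> borel_measurable M"
    if [measurable]: "f \<in> borel_measurable M" "Z \<in> borel_measurable M" for f :: "'a \<Rightarrow> 'c" and Z :: "'a \<Rightarrow> 'b"
    using borel_measurable_continuous_on[OF cont, of "\<lambda>x. (f x, Z x)" M] by simp
  have lim: "(\<lambda>i. (\<integral>x. indicator A x *\<^sub>R H (s i x) (Z x) \<partial>M)) \<longlonglongrightarrow> (\<integral>x. indicator A x *\<^sub>R H (a x) (Z x) \<partial>M)"
    if Z: "integrable M Z" and iZ: "integrable M (\<lambda>x. norm (a x) powr r * norm (Z x))" for Z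
  proof (rule integral_dominated_convergence[where w = "\<lambda>x. K * 2 powr r * (norm (a x) powr r * norm (Z x))"])
    note [measurable] = borel_measurable_integrable[OF Z]
    show "(\<lambda>x. indicator A x *\<^sub>R H (a x) (Z x)) \<in> borel_measurable M"
      by (intro borel_measurable_scaleR meas) auto
    show "(\<lambda>x. indicator A x *\<^sub>R H (s i x) (Z x)) \<in> borel_measurable M" for i
      by (intro borel_measurable_scaleR meas) auto
    show "integrable M (\<lambda>x. K * 2 powr r * (norm (a x) powr r * norm (Z x)))" using iZ by simp
    show "AE x in M. (\<lambda>i. indicator A x *\<^sub>R H (s i x) (Z x)) \<longlonglongrightarrow> indicator A x *\<^sub>R H (a x) (Z x)"
    proof (rule AE_I2)
      fix x assume "x \<in> space M"
      then have "(\<lambda>i. H (s i x)) \<longlonglongrightarrow> H (a x)"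
        using s(2) H by (intro isCont_tendsto_compose[of _ H]) (auto simp: continuous_on_eq_continuous_at)
      then show "(\<lambda>i. indicator A x *\<^sub>R H (s i x) (Z x)) \<longlonglongrightarrow> indicator A x *\<^sub>R H (a x) (Z x)"
        by (intro tendsto_intros)
    qed
    show "AE x in M. norm (indicator A x *\<^sub>R H (s i x) (Z x)) \<le> K * 2 powr r * (norm (a x) powr r * norm (Z x))" for i
    proof (rule AE_I2)
      fix x assume x: "x \<in> space M"
      have "norm (indicator A x *\<^sub>R H (s i x) (Z x)) \<le> norm (H (s i x) (Z x))" by (auto simp: indicator_def)
      also have "\<dots> \<le> norm (H (s i x)) * norm (Z x)" by (rule norm_blinfun)
      also have "\<dots> \<le> (K * norm (s i x) powr r) * norm (Z x)" by (intro mult_right_mono bound) auto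
      also have "\<dots> \<le> (K * (2 * norm (a x)) powr r) * norm (Z x)"
        using s(3)[OF x] assms by (intro mult_right_mono mult_left_mono powr_mono2) auto
      also have "\<dots> = K * 2 powr r * (norm (a x) powr r * norm (Z x))" by (simp add: powr_mult)
      finally show "norm (indicator A x *\<^sub>R H (s i x) (Z x)) \<le> K * 2 powr r * (norm (a x) powr r * norm (Z x))" .
    qed
  qed
  show ?thesis
    using lim[OF X i(1)] lim[OF Y i(2)] unfolding is_cond_expB_pull_out_simple[OF sub X h s(1) A]
    by (rule LIMSEQ_unique)
qed

section \<open>The gradient of a power of the norm\<close>

text \<open>Tangent inequality of a convex function at \<open>y\<close>: the difference quotients
  from \<open>y\<close> towards \<open>x\<close> are at most \<open>?\<psi> x - ?\<psi> y\<close>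
  for steps in the open unit interval; the step then tends to 0 from the right.\<close>

lemma norm_powr_gradient_ineq:
  fixes p :: real and x y :: "'b::real_normed_vector"
  assumes p: "p \<ge> 1" and D: "((\<lambda>y. norm y powr p) has_derivative D) (at y)"
  shows "norm y powr p - norm x powr p \<le> D (y - x)"
proof -
  let ?\<psi> = "\<lambda>z::'b. norm z powr p"
  let ?\<phi> = "\<lambda>t. ?\<psi> (y + t *\<^sub>R (x - y))"
  have lin: "linear D" using D has_derivative_linear by blast
  have "((\<lambda>t::real. y + t *\<^sub>R (x - y)) has_derivative (\<lambda>t. t *\<^sub>R (x - y))) (at 0)"
    by (auto intro!: derivative_eq_intros)
  from has_derivative_compose[OF this, of ?\<psi> D] D
  have "(?\<phi> has_derivative (\<lambda>t. D (t *\<^sub>R (x - y)))) (at 0)" by simp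
  then have "(?\<phi> has_real_derivative D (x - y)) (at 0)"
    by (simp add: has_field_derivative_def linear_scale[OF lin] mult_commute_abs)
  then have "((\<lambda>h. (?\<phi> h - ?\<psi> y) / h) \<longlongrightarrow> D (x - y)) (at 0)"
    by (simp add: DERIV_def)
  then have "((\<lambda>h. (?\<phi> h - ?\<psi> y) / h) \<longlongrightarrow> D (x - y)) (at_right 0)"
    by (rule filterlim_mono) (auto simp: at_within_le_at)
  moreover have "\<forall>\<^sub>F h in at_right (0::real). (?\<phi> h - ?\<psi> y) / h \<le> ?\<psi> x - ?\<psi> y"
  proof (rule eventually_at_rightI[of 0 1])
    fix h :: real assume h: "h \<in> {0<..<1}"
    have "?\<psi> ((1 - h) *\<^sub>R y + h *\<^sub>R x) \<le> (1 - h) * ?\<psi> y + h * ?\<psi> x"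
      using h by (intro convex_onD[OF convex_on_norm_powr[OF p]]) auto
    moreover have "(1 - h) *\<^sub>R y + h *\<^sub>R x = y + h *\<^sub>R (x - y)" by (simp add: algebra_simps)
    ultimately have "?\<phi> h \<le> (1 - h) * ?\<psi> y + h * ?\<psi> x" by simp
    then show "(?\<phi> h - ?\<psi> y) / h \<le> ?\<psi> x - ?\<psi> y" using h by (simp add: field_simps)
  qed simp
  ultimately have "D (x - y) \<le> ?\<psi> x - ?\<psi> y"
    by (intro tendsto_upperbound[of _ _ "at_right 0"]) auto
  moreover have "D (x - y) = - D (y - x)" using linear_neg[OF lin, of "y - x"] by simp
  ultimately show ?thesis by simp
qed

section \<open>Power inequalities and a discrete Bihari lemma\<close>

text \<open>Tangent bound of a concave power at \<open>x\<close>, obtained from Young's inequality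
  for \<open>x + d\<close> and \<open>x\<close> after multiplication by
  \<open>x powr (\<alpha> - 1)\<close>.\<close>

lemma powr_add_le:
  fixes x d \<alpha> :: real
  assumes "0 < x" "0 \<le> d" "0 < \<alpha>" "\<alpha> \<le> 1"
  shows "(x + d) powr \<alpha> \<le> x powr \<alpha> + \<alpha> * x powr (\<alpha> - 1) * d"
proof -
  have 1: "x powr (1 - \<alpha>) * x powr (\<alpha> - 1) = 1" and 2: "x * x powr (\<alpha> - 1) = x powr \<alpha>"
    using assms by (simp_all add: powr_add[symmetric] powr_mult_base)
  have "(x + d) powr \<alpha> = (x + d) powr \<alpha> * (x powr (1 - \<alpha>) * x powr (\<alpha> - 1))" by (simp only: 1 mult_1_right)
  also have "\<dots> = ((x + d) powr \<alpha> * x powr (1 - \<alpha>)) * x powr (\<alpha> - 1)" by simp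
  also have "(x + d) powr \<alpha> * x powr (1 - \<alpha>) \<le> \<alpha> * (x + d) + (1 - \<alpha>) * x"
    using assms by (intro Youngs_inequality_0) auto
  also have "(\<alpha> * (x + d) + (1 - \<alpha>) * x) * x powr (\<alpha> - 1) = x * x powr (\<alpha> - 1) + \<alpha> * x powr (\<alpha> - 1) * d"
    by (simp add: algebra_simps)
  finally show ?thesis by (simp add: 2 mult_right_mono)
qed

text \<open>The majorant \<open>g\<close> adds \<eta> to the right-hand side. By the tangent bound,
  \<open>g powr \<alpha>\<close> grows by at most \<open>\<alpha> * \<beta> m\<close> per step:
  since \<open>f m + \<eta> \<le> g m\<close>, the factor \<open>g m powr (\<alpha> - 1)\<close>
  cancels the nonlinearity. A positive \<eta> keeps \<open>g\<close> positive.\<close>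

lemma discrete_Bihari:
  fixes f \<beta> :: "nat \<Rightarrow> real" and \<alpha> \<eta> :: real
  assumes \<alpha>: "0 < \<alpha>" "\<alpha> \<le> 1" and "0 < \<eta>"
    and f0: "\<And>m. m \<le> M \<Longrightarrow> 0 \<le> f m" and \<beta>: "\<And>i. i < M \<Longrightarrow> 0 \<le> \<beta> i"
    and f: "\<And>m. m \<le> M \<Longrightarrow> f m \<le> (\<Sum>i<m. \<beta> i * (f i + \<eta>) powr (1 - \<alpha>))"
  shows "(f M + \<eta>) powr \<alpha> \<le> \<eta> powr \<alpha> + \<alpha> * (\<Sum>i<M. \<beta> i)"
proof -
  define g where "g m = \<eta> + (\<Sum>i<m. \<beta> i * (f i + \<eta>) powr (1 - \<alpha>))" for m
  have fg: "f m + \<eta> \<le> g m" if "m \<le> M" for m using f[OF that] by (simp add: g_def)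
  have "g m powr \<alpha> \<le> \<eta> powr \<alpha> + \<alpha> * (\<Sum>i<m. \<beta> i)" if "m \<le> M" for m
    using that
  proof (induct m)
    case 0 then show ?case by (simp add: g_def)
  next
    case (Suc m)
    have gp: "0 < g m" using fg[of m] f0[of m] Suc assms by linarith
    have "g (Suc m) powr \<alpha> = (g m + \<beta> m * (f m + \<eta>) powr (1 - \<alpha>)) powr \<alpha>"
      by (simp add: g_def algebra_simps)
    also have "\<dots> \<le> g m powr \<alpha> + \<alpha> * g m powr (\<alpha> - 1) * (\<beta> m * (f m + \<eta>) powr (1 - \<alpha>))"
      using gp Suc assms by (intro powr_add_le) auto
    also have "\<dots> \<le> g m powr \<alpha> + \<alpha> * g m powr (\<alpha> - 1) * (\<beta> m * g m powr (1 - \<alpha>))"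
      using Suc \<alpha> f0[of m] fg[of m] \<beta>[of m] \<open>0 < \<eta>\<close>
      by (intro add_left_mono mult_left_mono powr_mono2) auto
    also have "\<dots> = g m powr \<alpha> + \<alpha> * \<beta> m"
    proof -
      have "g m powr (\<alpha> - 1) * g m powr (1 - \<alpha>) = 1" using gp by (simp add: powr_add[symmetric])
      then show ?thesis by (simp add: algebra_simps)
    qed
    finally show ?case using Suc by (simp add: algebra_simps)
  qed
  moreover have "(f M + \<eta>) powr \<alpha> \<le> g M powr \<alpha>"
    using fg[of M] f0[of M] assms by (intro powr_mono2) auto
  ultimately show ?thesis by fastforce
qed

text \<open>Young's inequality gives the tangent bound of the convex power at \<open>b\<close>; the
  increment \<open>b - a\<close> is then at most \<open>R * \<delta>\<close>. It controls the change
  of \<open>norm powr p\<close> over one grid step, with \<delta> the step length.\<close>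

lemma powr_le_powr_add:
  fixes a b R p \<delta> :: real
  assumes "p > 1" "0 \<le> a" "0 \<le> b" "b \<le> R" "b \<le> a + R * \<delta>" "0 \<le> \<delta>"
  shows "b powr p \<le> a powr p + p * R powr p * \<delta>"
proof -
  \<comment> \<open>\<open>p / (p - 1)\<close> is the exponent conjugate to
    \<open>p\<close>.\<close>
  have q: "p / (p - 1) > 1" "1 / p + 1 / (p / (p - 1)) = 1" using assms by (auto simp: field_simps)
  have m: "z * z powr (p - 1) = z powr p" if "0 \<le> z" for z using that by (simp add: powr_mult_base)
  have "a * b powr (p - 1) \<le> a powr p / p + (b powr (p - 1)) powr (p / (p - 1)) / (p / (p - 1))"
    using assms q by (intro Youngs_inequality) auto
  also have "(b powr (p - 1)) powr (p / (p - 1)) = b powr p" using assms by (simp add: powr_powr)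
  finally have "p * (a * b powr (p - 1)) \<le> a powr p + (p - 1) * b powr p"
    using assms by (simp add: field_simps)
  then have "b powr p \<le> a powr p + p * (b powr (p - 1) * (b - a))"
    using m[of b] assms by (simp add: algebra_simps)
  also have "b powr (p - 1) * (b - a) \<le> R powr (p - 1) * (R * \<delta>)"
  proof (cases "a \<le> b")
    case True then show ?thesis using assms by (intro mult_mono powr_mono2) auto
  next
    case False
    then have "b powr (p - 1) * (b - a) \<le> 0" by (simp add: mult_nonneg_nonpos)
    also have "0 \<le> R powr (p - 1) * (R * \<delta>)" using assms by auto
    finally show ?thesis .
  qed
  also have "R powr (p - 1) * (R * \<delta>) = R powr p * \<delta>" using m[of R] assms by (simp add: algebra_simps)
  finally show ?thesis using assms by (simp add: algebra_simps)
qed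

text \<open>The partial sums of \<open>X\<close>, interpolated linearly with \<open>N\<close> grid points per step; point \<open>m\<close> lies in the step
  of \<open>X (Suc (m div N))\<close>.\<close>

definition grid_path :: "nat \<Rightarrow> (nat \<Rightarrow> 'b) \<Rightarrow> nat \<Rightarrow> 'b::real_vector" where
  "grid_path N X m = (\<Sum>i=1..m div N. X i) + (real (m mod N) / real N) *\<^sub>R X (Suc (m div N))"

lemma grid_path_0 [simp]: "grid_path N X 0 = 0"
  by (simp add: grid_path_def)

lemma grid_path_mult [simp]: "N > 0 \<Longrightarrow> grid_path N X (n * N) = (\<Sum>i=1..n. X i)"
  by (simp add: grid_path_def)

lemma grid_path_Suc:
  assumes "N > 0"
  shows "grid_path N X (Suc m) = grid_path N X m + (1 / real N) *\<^sub>R X (Suc (m div N))"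
proof (cases "Suc (m mod N) = N")
  \<comment> \<open>At the last point of a block the fraction wraps around to 0, and the weights (N
    - 1) / N and 1 / N complete one full summand.\<close>
  case True
  then have "real N = real (m mod N) + 1" by linarith
  then have "X (Suc (m div N)) = (real (m mod N) / real N) *\<^sub>R X (Suc (m div N)) + (1 / real N) *\<^sub>R X (Suc (m div N))"
    using assms by (simp add: scaleR_add_left[symmetric] add_divide_distrib[symmetric])
  then show ?thesis using True by (simp add: grid_path_def div_Suc mod_Suc add.assoc)
next
  case False
  then show ?thesis
    by (simp add: grid_path_def div_Suc mod_Suc[of m] add_divide_distrib scaleR_add_left add.assoc)
qed

text \<open>Reduces a test vector at a grid point to differences of partial sums at the two ends of
  its block; these are sums of whole increments and can be conditioned.\<close>

lemma grid_path_diff: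
  "grid_path N X m - (\<Sum>i=1..j. X i) =
    (1 - real (m mod N) / real N) *\<^sub>R ((\<Sum>i=1..m div N. X i) - (\<Sum>i=1..j. X i))
    + (real (m mod N) / real N) *\<^sub>R ((\<Sum>i=1..Suc (m div N). X i) - (\<Sum>i=1..j. X i))"
  by (simp add: grid_path_def algebra_simps)

text \<open>Linearizing \<open>\<psi>(S r) - \<psi>(S (r - 1)) \<le> D (S r) (X r)\<close> only at the block ends keeps the full increment
  as test vector and, by convexity, makes a second order remainder unnecessary.\<close>

lemma norm_powr_grid_path_le:
  fixes D :: "'b::real_normed_vector \<Rightarrow> ('b \<Rightarrow>\<^sub>L real)"
  assumes p: "p \<ge> 1" and D: "\<And>x. ((\<lambda>y. norm y powr p) has_derivative blinfun_apply (D x)) (at x)"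
    and D0: "D 0 = 0" and N: "N > 0"
  shows "norm (grid_path N X m) powr p \<le>
    (\<Sum>i<m. (D (grid_path N X (Suc i)) - D (grid_path N X i)) (grid_path N X m - (\<Sum>k=1..i div N. X k)))"
proof -
  let ?y = "grid_path N X"
  define S where "S r = (\<Sum>k=1..r. X k)" for r
  define T where "T m = (\<Sum>i<m. (D (?y (Suc i)) - D (?y i)) (S (i div N)))" for m
  \<comment> \<open>Summation by parts: \<open>T\<close> collects gradient increments against the
    partial sum at the start of the block. Inside a block both sides change consistently; at a block
    end the gradient inequality pays for the new increment.\<close>
  have inv: "norm (S (m div N)) powr p \<le> D (?y m) (S (m div N)) - T m" for m
  proof (induct m)
    case 0 then show ?case by (simp add: S_def T_def)
  next
    case (Suc m)
    have eq: "D (?y (Suc m)) (S (Suc m div N)) - T (Suc m)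
        = D (?y m) (S (m div N)) - T m + D (?y (Suc m)) (S (Suc m div N) - S (m div N))"
      by (simp add: T_def blinfun.diff_left blinfun.diff_right)
    show ?case
    proof (cases "Suc (m mod N) = N")
      case True
      then have "?y (Suc m) = S (Suc m div N)" by (simp add: grid_path_def S_def mod_Suc)
      then have "norm (S (Suc m div N)) powr p - norm (S (m div N)) powr p
          \<le> D (?y (Suc m)) (S (Suc m div N) - S (m div N))"
        using norm_powr_gradient_ineq[OF p D] by simp
      then show ?thesis using eq Suc by linarith
    next
      case False
      then have "Suc m div N = m div N" by (simp add: div_Suc mod_Suc)
      then show ?thesis using eq Suc by simp
    qed
  qed
  \<comment> \<open>For a fixed vector the increments telescope, and \<open>D 0 = 0\<close> removes
    the initial term.\<close>
  have tel: "(\<Sum>i<m. (D (?y (Suc i)) - D (?y i)) z) = D (?y m) z" for z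
    by (induct m) (auto simp: blinfun.diff_left D0)
  have "(\<Sum>i<m. (D (?y (Suc i)) - D (?y i)) (?y m - S (i div N))) = D (?y m) (?y m) - T m"
    by (simp add: blinfun.diff_right sum_subtractf tel T_def)
  moreover have "norm (?y m) powr p - norm (S (m div N)) powr p \<le> D (?y m) (?y m - S (m div N))"
    by (rule norm_powr_gradient_ineq[OF p D])
  ultimately show ?thesis using inv[of m] by (simp add: S_def blinfun.diff_right)
qed

section \<open>Gradient bounds from the second derivative\<close>

text \<open>The origin is a minimum.\<close>

lemma derivative_norm_powr_0:
  assumes p: "p > 0" and D: "((\<lambda>y::'b::real_normed_vector. norm y powr p) has_derivative D) (at 0)"
  shows "D = (\<lambda>v. 0)"
  by (rule differential_zero_maxmin[OF _ open_UNIV D]) auto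

text \<open>Mean value inequality for \<open>\<lambda>z. D1 z v\<close> on the segment. Convexity of
  \<open>norm powr p\<close> carries the bound \<open>u\<close> from the endpoints to the whole
  segment, where it controls \<open>pow0 (norm z) (p - 2)\<close>.\<close>

lemma derivative_norm_powr_lipschitz:
  fixes D1 :: "'b::real_normed_vector \<Rightarrow> ('b \<Rightarrow>\<^sub>L real)" and D2 :: "'b \<Rightarrow> ('b \<Rightarrow>\<^sub>L ('b \<Rightarrow>\<^sub>L real))"
  assumes p: "p \<ge> 2" and C: "C \<ge> 0"
    and D2: "\<And>x. (D1 has_derivative blinfun_apply (D2 x)) (at x)"
    and bound: "\<And>x u v. \<bar>D2 x u v\<bar> \<le> C * pow0 (norm x) (p - 2) * norm u * norm v"
    and u: "0 < u" "norm x powr p \<le> u" "norm y powr p \<le> u"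
  shows "\<bar>(D1 y - D1 x) v\<bar> \<le> C * norm (y - x) * norm v * u powr (1 - 2 / p)"
proof -
  have z: "pow0 (norm z) (p - 2) \<le> u powr (1 - 2 / p)" if seg: "z \<in> closed_segment x y" for z
  proof (cases "p = 2")
    \<comment> \<open>Both sides equal 1 here, which uses \<open>u > 0\<close> because
      \<open>0 powr 0 = 0\<close>.\<close>
    case True then show ?thesis using u by (simp add: pow0_def)
  next
    case False
    obtain t where t: "0 \<le> t" "t \<le> 1" "z = (1 - t) *\<^sub>R x + t *\<^sub>R y"
      using seg by (auto simp: closed_segment_def)
    have "norm z powr p \<le> (1 - t) * norm x powr p + t * norm y powr p"
      unfolding t(3) using t p by (intro convex_onD[OF convex_on_norm_powr]) auto
    also have "\<dots> \<le> (1 - t) * u + t * u" using t u by (intro add_mono mult_left_mono) auto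
    finally have "norm z powr p \<le> u" by (simp add: algebra_simps)
    then have "(norm z powr p) powr (1 - 2 / p) \<le> u powr (1 - 2 / p)" using p by (intro powr_mono2) auto
    moreover have "p * (1 - 2 / p) = p - 2" using p by (simp add: field_simps)
    ultimately show ?thesis using False p by (simp add: pow0_def powr_powr)
  qed
  let ?B = "C * u powr (1 - 2 / p) * norm v"
  have "norm (D1 y v - D1 x v) \<le> ?B * norm (y - x)"
  proof (rule differentiable_bound[of "closed_segment x y" "\<lambda>z. D1 z v" "\<lambda>z h. D2 z h v"])
    fix z assume z': "z \<in> closed_segment x y"
    have "((\<lambda>z. D1 z v) has_derivative (\<lambda>h. D2 z h v)) (at z)"
      by (rule bounded_linear.has_derivative[OF blinfun.bounded_linear_left D2])
    then show "((\<lambda>z. D1 z v) has_derivative (\<lambda>h. D2 z h v)) (at z within closed_segment x y)"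
      by (rule has_derivative_at_withinI)
    show "onorm (\<lambda>h. D2 z h v) \<le> ?B"
    proof (rule onorm_bound)
      fix h
      have "norm (D2 z h v) \<le> C * pow0 (norm z) (p - 2) * norm h * norm v" using bound by simp
      also have "\<dots> \<le> C * u powr (1 - 2 / p) * norm h * norm v"
        using z[OF z'] C by (intro mult_right_mono mult_left_mono) auto
      finally show "norm (D2 z h v) \<le> ?B * norm h" by (simp add: algebra_simps)
    qed (use C in auto)
  qed auto
  then show ?thesis by (simp add: blinfun.diff_left algebra_simps)
qed

text \<open>The Lipschitz bound from the origin, with \<open>u\<close> equal to
  \<open>norm x powr p\<close>; this \<open>u\<close> is positive only for nonzero
  \<open>x\<close>.\<close>

lemma norm_derivative_norm_powr_le:
  fixes D1 :: "'b::real_normed_vector \<Rightarrow> ('b \<Rightarrow>\<^sub>L real)" and D2 :: "'b \<Rightarrow> ('b \<Rightarrow>\<^sub>L ('b \<Rightarrow>\<^sub>L real))"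
  assumes p: "p \<ge> 2" and C: "C \<ge> 0"
    and D2: "\<And>x. (D1 has_derivative blinfun_apply (D2 x)) (at x)"
    and bound: "\<And>x u v. \<bar>D2 x u v\<bar> \<le> C * pow0 (norm x) (p - 2) * norm u * norm v"
    and D0: "D1 0 = 0"
  shows "norm (D1 x) \<le> C * norm x powr (p - 1)"
proof (cases "x = 0")
  case True then show ?thesis by (simp add: D0)
next
  case False
  have e: "norm x * (norm x powr p) powr (1 - 2 / p) = norm x powr (p - 1)"
  proof -
    have "p * (1 - 2 / p) = p - 2" using p by (simp add: field_simps)
    then show ?thesis by (simp add: powr_powr powr_mult_base)
  qed
  show ?thesis
  proof (rule norm_blinfun_bound)
    fix v
    have "norm (D1 x v) \<le> C * norm x * norm v * (norm x powr p) powr (1 - 2 / p)"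
      using derivative_norm_powr_lipschitz[OF p C D2 bound, of "norm x powr p" 0 x v] False p by (simp add: D0)
    also have "\<dots> = C * (norm x * (norm x powr p) powr (1 - 2 / p)) * norm v" by (simp add: algebra_simps)
    finally show "norm (D1 x v) \<le> C * norm x powr (p - 1) * norm v" by (simp only: e)
  qed (use C in auto)
qed

section \<open>Conditional Hoelder inequality\<close>

lemma weighted_powr_le:
  fixes u v \<alpha> :: real
  assumes "0 < u" "0 \<le> v" "0 < \<alpha>" "\<alpha> \<le> 1"
  shows "u powr (1 - \<alpha>) * v powr \<alpha> \<le> (1 - \<alpha>) * u + \<alpha> * v"
  using Youngs_inequality_0[of "1 - \<alpha>" \<alpha> u v] assms by (cases "v = 0") auto

lemma (in finite_measure_subalgebra) integrable_divide_bounded_below: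
  fixes g h :: "'a \<Rightarrow> real"
  assumes "integrable M g" and [measurable]: "h \<in> borel_measurable M" and "0 < \<delta>" "\<And>x. \<delta> \<le> h x"
  shows "integrable M (\<lambda>x. g x / h x)"
proof (rule Bochner_Integration.integrable_bound[of _ "\<lambda>x. g x / \<delta>"])
  show "AE x in M. norm (g x / h x) \<le> norm (g x / \<delta>)"
    using assms(3,4) by (intro AE_I2) (auto intro!: divide_left_mono mult_pos_pos simp: abs_of_pos less_le_trans[OF assms(3)])
qed (use assms in auto)

lemma (in finite_measure_subalgebra) real_cond_exp_divide:
  fixes g h :: "'a \<Rightarrow> real"
  assumes g: "integrable M g" and h[measurable]: "h \<in> borel_measurable F" and \<delta>: "0 < \<delta>" "\<And>x. \<delta> \<le> h x"
  shows "AE x in M. real_cond_exp M F (\<lambda>x. g x / h x) x = real_cond_exp M F g x / h x"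
proof -
  have [measurable]: "h \<in> borel_measurable M" by (rule measurable_from_subalg[OF subalg h])
  have "integrable M (\<lambda>x. 1 / h x * g x)"
    using integrable_divide_bounded_below[OF g _ \<delta>] by simp
  then show ?thesis using real_cond_exp_mult[of "\<lambda>x. 1 / h x" g] g by auto
qed

text \<open>Normalize by the conditional expectations, apply weighted AM-GM to the quotients
  pointwise, and condition: the two resulting means are at most 1.\<close>

lemma (in finite_measure_subalgebra) real_cond_exp_Holder:
  fixes u v :: "'a \<Rightarrow> real" and \<alpha> :: real
  assumes u: "integrable M u" and v: "integrable M v"
    and \<delta>: "0 < \<delta>" "\<And>x. \<delta> \<le> u x" and v0: "\<And>x. 0 \<le> v x" and \<alpha>: "0 < \<alpha>" "\<alpha> \<le> 1"
  shows "integrable M (\<lambda>x. u x powr (1 - \<alpha>) * v x powr \<alpha>)" (is "integrable M ?w")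
    and "AE x in M. real_cond_exp M F (\<lambda>x. u x powr (1 - \<alpha>) * v x powr \<alpha>) x
      \<le> real_cond_exp M F u x powr (1 - \<alpha>) * real_cond_exp M F v x powr \<alpha>"
proof -
  have u0: "0 < u x" for x using \<delta> less_le_trans by blast
  have Y: "?w x \<le> (1 - \<alpha>) * u x + \<alpha> * v x" for x using u0 v0 \<alpha> by (rule weighted_powr_le)
  note [measurable] = borel_measurable_integrable[OF u] borel_measurable_integrable[OF v]
  show w: "integrable M ?w"
    by (rule Bochner_Integration.integrable_bound[of _ "\<lambda>x. (1 - \<alpha>) * u x + \<alpha> * v x"])
      (use u v Y in \<open>auto intro: order_trans[OF _ abs_ge_self]\<close>)
  let ?E = "real_cond_exp M F"
  have ge: "AE x in M. \<delta> \<le> ?E u x" "AE x in M. 0 \<le> ?E v x"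
    using u v \<delta>(2) v0 by (auto intro!: real_cond_exp_ge_c)
  have main: "AE x in M. ?E ?w x \<le> ?E u x powr (1 - \<alpha>) * (?E v x + \<epsilon>) powr \<alpha>" if \<epsilon>: "0 < \<epsilon>" for \<epsilon>
  proof -
    \<comment> \<open>The maximum and the added \<epsilon> bound \<open>a\<close> and
      \<open>b\<close> below by positive constants everywhere, so the quotients are integrable and
      the denominators can be pulled out. Almost surely \<open>a\<close> is the conditional
      expectation of \<open>u\<close> itself.\<close>
    define a where "a x = max \<delta> (?E u x)" for x
    define b where "b x = max 0 (?E v x) + \<epsilon>" for x
    define h where "h x = a x powr (1 - \<alpha>) * b x powr \<alpha>" for x
    have [measurable]: "a \<in> borel_measurable F" "b \<in> borel_measurable F" "h \<in> borel_measurable F"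
      unfolding a_def b_def h_def by measurable
    note [measurable] = this[THEN measurable_from_subalg[OF subalg]]
    have ab: "\<delta> \<le> a x" "\<epsilon> \<le> b x" for x by (auto simp: a_def b_def)
    have ab0: "0 < a x" "0 < b x" for x using ab[of x] \<delta> \<epsilon> by linarith+
    define \<kappa> where "\<kappa> = \<delta> powr (1 - \<alpha>) * \<epsilon> powr \<alpha>"
    have h: "0 < \<kappa>" "\<kappa> \<le> h x" for x
      using \<delta> \<epsilon> \<alpha> ab[of x] unfolding \<kappa>_def h_def by (auto intro!: mult_mono powr_mono2)
    have ia: "integrable M (\<lambda>x. u x / a x)" and ib: "integrable M (\<lambda>x. v x / b x)"
      and ih: "integrable M (\<lambda>x. ?w x / h x)"
      by (rule integrable_divide_bounded_below[OF u _ \<delta>(1) ab(1)] integrable_divide_bounded_below[OF v _ \<epsilon> ab(2)]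
        integrable_divide_bounded_below[OF w _ h(1) h(2)], measurable)+
    have "?w x / h x \<le> (1 - \<alpha>) * (u x / a x) + \<alpha> * (v x / b x)" for x
    proof -
      have "?w x / h x = (u x / a x) powr (1 - \<alpha>) * (v x / b x) powr \<alpha>"
        using u0[of x] v0[of x] ab0[of x] by (simp add: h_def powr_divide)
      then show ?thesis using weighted_powr_le[of "u x / a x" "v x / b x" \<alpha>] u0[of x] v0[of x] ab0[of x] \<alpha> by simp
    qed
    moreover have ia': "integrable M (\<lambda>x. (1 - \<alpha>) * (u x / a x))" by (rule integrable_mult_right) (rule ia)
    moreover have ib': "integrable M (\<lambda>x. \<alpha> * (v x / b x))" by (rule integrable_mult_right) (rule ib)
    ultimately have 1: "AE x in M. ?E (\<lambda>x. ?w x / h x) x \<le> ?E (\<lambda>x. (1 - \<alpha>) * (u x / a x) + \<alpha> * (v x / b x)) x"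
      using ih by (intro real_cond_exp_mono Bochner_Integration.integrable_add AE_I2)
    have 2: "AE x in M. ?E (\<lambda>x. (1 - \<alpha>) * (u x / a x) + \<alpha> * (v x / b x)) x
      = ?E (\<lambda>x. (1 - \<alpha>) * (u x / a x)) x + ?E (\<lambda>x. \<alpha> * (v x / b x)) x"
      using ia' ib' by (rule real_cond_exp_add)
    note 3 = real_cond_exp_cmult[OF ia, of "1 - \<alpha>"] real_cond_exp_cmult[OF ib, of \<alpha>]
    have 4: "AE x in M. ?E (\<lambda>x. u x / a x) x = ?E u x / a x"
      by (rule real_cond_exp_divide[OF u _ \<delta>(1) ab(1)]) measurable
    have 5: "AE x in M. ?E (\<lambda>x. v x / b x) x = ?E v x / b x"
      by (rule real_cond_exp_divide[OF v _ \<epsilon> ab(2)]) measurable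
    have 6: "AE x in M. ?E (\<lambda>x. ?w x / h x) x = ?E ?w x / h x"
      by (rule real_cond_exp_divide[OF w _ h(1) h(2)]) measurable
    show ?thesis using 1 2 3 4 5 6 ge
    proof eventually_elim
      case (elim x)
      have eq: "a x = ?E u x" "b x = ?E v x + \<epsilon>" using elim by (auto simp: a_def b_def)
      have "?E ?w x / h x \<le> (1 - \<alpha>) * (?E u x / a x) + \<alpha> * (?E v x / b x)"
        using elim(1) by (simp only: elim(2-7))
      also have "\<dots> \<le> (1 - \<alpha>) * 1 + \<alpha> * 1"
        using elim \<alpha> ab0[of x] \<epsilon> by (intro add_mono mult_left_mono) (auto simp: eq)
      finally have "?E ?w x \<le> h x" using h(1) h(2)[of x] by (simp add: divide_le_eq split: if_splits)
      then show ?case by (simp add: h_def eq)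
    qed
  qed
  \<comment> \<open>Countably many values of \<epsilon> share one null set, outside of which
    \<epsilon> tends to 0.\<close>
  have "AE x in M. \<forall>k. ?E ?w x \<le> ?E u x powr (1 - \<alpha>) * (?E v x + 1 / real (Suc k)) powr \<alpha>"
    by (subst AE_all_countable) (intro allI main, simp)
  then show "AE x in M. ?E ?w x \<le> ?E u x powr (1 - \<alpha>) * ?E v x powr \<alpha>"
    using ge(2)
  proof eventually_elim
    case (elim x)
    have "(\<lambda>k. ?E v x + 1 / real (Suc k)) \<longlonglongrightarrow> ?E v x + 0"
      by (intro tendsto_add tendsto_const LIMSEQ_Suc lim_1_over_n)
    then have "(\<lambda>k. ?E u x powr (1 - \<alpha>) * (?E v x + 1 / real (Suc k)) powr \<alpha>)
      \<longlonglongrightarrow> ?E u x powr (1 - \<alpha>) * ?E v x powr \<alpha>"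
      using elim \<alpha> by (intro tendsto_mult tendsto_const tendsto_powr2) auto
    then show ?case using elim by (intro LIMSEQ_le_const) auto
  qed
qed

lemma (in finite_measure_subalgebra) real_cond_exp_sum_on:
  fixes f :: "'i \<Rightarrow> 'a \<Rightarrow> real"
  assumes "\<And>i. i \<in> I \<Longrightarrow> integrable M (f i)"
  shows "AE x in M. real_cond_exp M F (\<lambda>x. \<Sum>i\<in>I. f i x) x = (\<Sum>i\<in>I. real_cond_exp M F (f i) x)"
proof -
  \<comment> \<open>Extension by zero gives a family that is integrable for every index.\<close>
  let ?g = "\<lambda>i. if i \<in> I then f i else (\<lambda>_. 0)"
  have "AE x in M. real_cond_exp M F (\<lambda>x. \<Sum>i\<in>I. ?g i x) x = (\<Sum>i\<in>I. real_cond_exp M F (?g i) x)"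
    using assms by (intro real_cond_exp_sum) auto
  moreover have "(\<lambda>x. \<Sum>i\<in>I. ?g i x) = (\<lambda>x. \<Sum>i\<in>I. f i x)" by (intro ext sum.cong) auto
  moreover have "(\<Sum>i\<in>I. real_cond_exp M F (?g i) x) = (\<Sum>i\<in>I. real_cond_exp M F (f i) x)" for x
    by (intro sum.cong) auto
  ultimately show ?thesis by simp
qed

section \<open>The moment inequality\<close>

lemma sum_div_eq:
  fixes g :: "nat \<Rightarrow> real"
  assumes "N > 0"
  shows "(\<Sum>i<n * N. g (i div N)) = real N * (\<Sum>j<n. g j)"
proof -
  have "(\<Sum>i<n * N. g (i div N)) = (\<Sum>j<n. \<Sum>i = j * N..<j * N + N. g (i div N))"
    by (rule sum.nat_group[symmetric])
  also have "\<dots> = (\<Sum>j<n. \<Sum>i = j * N..<j * N + N. g j)"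
  proof (intro sum.cong refl)
    fix j i assume "i \<in> {j * N..<j * N + N}"
    then have "i div N = j" using assms by (intro div_nat_eqI) (auto simp: mult.commute)
    then show "g (i div N) = g j" by simp
  qed
  finally show ?thesis by (simp add: sum_distrib_left)
qed

section \<open>The adapted setting and its integrable majorant\<close>

text \<open>Fixes witnesses \<open>D1\<close>, \<open>D2\<close> of the smoothness class and the
  horizon \<open>n\<close>, on which \<open>R\<close> and \<open>B\<close> depend. \<open>C\<close>
  stands for the maximum of \<open>c\<close> and \<open>p / 2\<close>.\<close>

locale smooth_adapted = prob_space M for M :: "'a measure" +
  fixes F :: "nat \<Rightarrow> 'a measure" and X :: "nat \<Rightarrow> 'a \<Rightarrow> 'b::{banach,second_countable_topology}"
    and p C :: real and n :: nat
    and D1 :: "'b \<Rightarrow> ('b \<Rightarrow>\<^sub>L real)" and D2 :: "'b \<Rightarrow> ('b \<Rightarrow>\<^sub>L ('b \<Rightarrow>\<^sub>L real))"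
  assumes p: "p \<ge> 2" and C: "C > 0"
    and D1: "\<And>x. ((\<lambda>y. norm y powr p) has_derivative blinfun_apply (D1 x)) (at x)"
    and D2: "\<And>x. (D1 has_derivative blinfun_apply (D2 x)) (at x)"
    and bound: "\<And>x u v. \<bar>D2 x u v\<bar> \<le> C * pow0 (norm x) (p - 2) * norm u * norm v"
    and sub: "\<And>i. subalgebra M (F i)"
    and incr: "\<And>i. sets (F i) \<subseteq> sets (F (Suc i))"
    and adapted: "\<And>i. i \<ge> 1 \<Longrightarrow> X i \<in> borel_measurable (F i)"
    and Xp: "\<And>i. i \<ge> 1 \<Longrightarrow> integrable M (\<lambda>\<omega>. norm (X i \<omega>) powr p)"
    and X1: "\<And>i. i \<ge> 1 \<Longrightarrow> integrable M (X i)"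
begin

definition S where "S r \<omega> = (\<Sum>k=1..r. X k \<omega>)"
text \<open>A common majorant for all partial sums, their differences and all grid points up to time
  \<open>n\<close>; integrability of \<open>R powr p\<close> yields all the domination needed for
  them.\<close>

definition R where "R \<omega> = (\<Sum>k=1..n. norm (X k \<omega>))"
definition T where "T i l \<omega> = (\<Sum>k=i..l. cond_expB M (F i) (X k) \<omega>)"
definition Y where "Y N m \<omega> = grid_path N (\<lambda>k. X k \<omega>) m"
definition DY where "DY N i \<omega> = D1 (Y N (Suc i) \<omega>) - D1 (Y N i \<omega>)"
definition V where "V i l \<omega> = norm (X i \<omega>) powr (p / 2) * norm (T i l \<omega>) powr (p / 2)"
definition B where
  "B i \<omega> = Max ((\<lambda>l. (real_cond_exp M (F 0) (V i l) \<omega>) powr (2 / p)) ` {i..n})"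

lemma D1_0: "D1 0 = 0"
  using derivative_norm_powr_0[of p "blinfun_apply (D1 0)"] D1[of 0] p
  by (intro blinfun_eqI) simp

lemma cont_D1: "continuous_on UNIV D1"
  using has_derivative_continuous[OF D2] by (simp add: continuous_at_imp_continuous_on)

lemma norm_D1_le: "norm (D1 x) \<le> C * norm x powr (p - 1)"
  using norm_derivative_norm_powr_le[OF p _ D2 bound D1_0] C by simp

lemma F0_locale: "finite_measure_subalgebra M (F 0)"
  by unfold_locales (rule sub)

lemma sets_F_mono: "i \<le> j \<Longrightarrow> sets (F i) \<subseteq> sets (F j)"
  using incr by (rule lift_Suc_mono_le)

lemma measurable_F_mono:
  assumes "i \<le> j" "f \<in> borel_measurable (F i)" shows "f \<in> borel_measurable (F j)"
  using assms sets_F_mono[OF assms(1)] sub[of i] sub[of j] unfolding measurable_def subalgebra_def by auto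

lemma X_measurable_F: "1 \<le> k \<Longrightarrow> k \<le> j \<Longrightarrow> X k \<in> borel_measurable (F j)"
  using adapted measurable_F_mono by blast

lemma X_measurable [measurable]: "1 \<le> k \<Longrightarrow> X k \<in> borel_measurable M"
  using X1 by auto

lemma R_nonneg: "0 \<le> R \<omega>" by (auto simp: R_def intro: sum_nonneg)

lemma R_measurable [measurable]: "R \<in> borel_measurable M"
  unfolding R_def by (intro borel_measurable_sum borel_measurable_norm X_measurable) auto

lemma integrable_R_powr: "integrable M (\<lambda>\<omega>. R \<omega> powr p)"
proof (rule Bochner_Integration.integrable_bound[of _ "\<lambda>\<omega>. real n powr p * (\<Sum>k=1..n. norm (X k \<omega>) powr p)"])
  show "integrable M (\<lambda>\<omega>. real n powr p * (\<Sum>k=1..n. norm (X k \<omega>) powr p))"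
    using Xp by auto
  have "R \<omega> powr p \<le> real n powr p * (\<Sum>k=1..n. norm (X k \<omega>) powr p)" for \<omega>
  proof (cases "n = 0")
    case True then show ?thesis unfolding R_def by simp
  next
    case False
    \<comment> \<open>\<open>R\<close> is at most \<open>n\<close> times the largest norm, whose
      power is one of the summands on the right.\<close>
    define m where "m = Max ((\<lambda>k. norm (X k \<omega>)) ` {1..n})"
    have "m \<in> (\<lambda>k. norm (X k \<omega>)) ` {1..n}" unfolding m_def using False by (intro Max_in) auto
    then obtain j where j: "j \<in> {1..n}" "m = norm (X j \<omega>)" by auto
    have "R \<omega> \<le> (\<Sum>k=1..n. m)" unfolding R_def m_def by (intro sum_mono Max_ge) auto
    then have "R \<omega> powr p \<le> (real n * m) powr p" using R_nonneg p by (intro powr_mono2) auto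
    also have "\<dots> = real n powr p * norm (X j \<omega>) powr p" using j by (simp add: powr_mult)
    also have "norm (X j \<omega>) powr p \<le> (\<Sum>k=1..n. norm (X k \<omega>) powr p)"
      using j by (intro member_le_sum) auto
    finally show ?thesis by (simp add: mult_left_mono)
  qed
  then show "AE \<omega> in M. norm (R \<omega> powr p) \<le> norm (real n powr p * (\<Sum>k=1..n. norm (X k \<omega>) powr p))"
    by (auto intro: order_trans[OF _ abs_ge_self])
qed measurable

lemma integrable_powr_le_R:
  assumes "f \<in> borel_measurable M" "\<And>\<omega>. norm (f \<omega>) \<le> K * R \<omega>" "0 \<le> K"
  shows "integrable M (\<lambda>\<omega>. norm (f \<omega> :: 'c::{banach,second_countable_topology}) powr p)"
proof (rule Bochner_Integration.integrable_bound[of _ "\<lambda>\<omega>. K powr p * R \<omega> powr p"])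
  show "AE \<omega> in M. norm (norm (f \<omega>) powr p) \<le> norm (K powr p * R \<omega> powr p)"
  proof (rule AE_I2)
    fix \<omega>
    have "norm (f \<omega>) powr p \<le> (K * R \<omega>) powr p" using assms p by (intro powr_mono2) auto
    then show "norm (norm (f \<omega>) powr p) \<le> norm (K powr p * R \<omega> powr p)"
      using assms R_nonneg by (simp add: powr_mult)
  qed
qed (use integrable_R_powr assms in auto)

lemma integrable_product_le_R:
  fixes g :: "'a \<Rightarrow> real" and Z :: "'a \<Rightarrow> 'b"
  assumes [measurable]: "g \<in> borel_measurable M" and g: "\<And>\<omega>. \<bar>g \<omega>\<bar> \<le> K * R \<omega> powr (p - 1) * norm (Z \<omega>)" and "0 \<le> K"
    and Z: "integrable M (\<lambda>\<omega>. norm (Z \<omega>) powr p)"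
  shows "integrable M g"
proof (rule Bochner_Integration.integrable_bound[of _ "\<lambda>\<omega>. K * (R \<omega> powr p + norm (Z \<omega>) powr p)"])
  show "integrable M (\<lambda>\<omega>. K * (R \<omega> powr p + norm (Z \<omega>) powr p))"
    using integrable_R_powr Z by auto
  \<comment> \<open>Replacing both factors by their maximum gives integrability of the product
    without Hoelder.\<close>
  have ab: "a powr (p - 1) * b \<le> a powr p + b powr p" if "0 \<le> a" "0 \<le> b" for a b :: real
  proof -
    have "a powr (p - 1) * b \<le> max a b powr (p - 1) * max a b"
      using that p by (intro mult_mono powr_mono2) auto
    also have "\<dots> = max a b powr p" using that by (simp add: powr_mult_base mult.commute)
    also have "\<dots> \<le> a powr p + b powr p" by (simp add: max_def)
    finally show ?thesis .
  qed
  show "AE \<omega> in M. norm (g \<omega>) \<le> norm (K * (R \<omega> powr p + norm (Z \<omega>) powr p))"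
  proof (rule AE_I2)
    fix \<omega>
    have "\<bar>g \<omega>\<bar> \<le> K * (R \<omega> powr (p - 1) * norm (Z \<omega>))" using g[of \<omega>] by (simp add: mult.assoc)
    also have "\<dots> \<le> K * (R \<omega> powr p + norm (Z \<omega>) powr p)"
      using ab[OF R_nonneg, of "norm (Z \<omega>)"] \<open>0 \<le> K\<close> by (intro mult_left_mono) auto
    finally show "norm (g \<omega>) \<le> norm (K * (R \<omega> powr p + norm (Z \<omega>) powr p))"
      using \<open>0 \<le> K\<close> by simp
  qed
qed measurable

lemma norm_X_le: "1 \<le> i \<Longrightarrow> i \<le> n \<Longrightarrow> norm (X i \<omega>) \<le> R \<omega>"
  unfolding R_def by (rule member_le_sum) auto

lemma norm_sum_X_le: "I \<subseteq> {1..n} \<Longrightarrow> norm (\<Sum>k\<in>I. X k \<omega>) \<le> R \<omega>"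
  unfolding R_def by (intro order_trans[OF norm_sum] sum_mono2) auto

lemma norm_S_le: "r \<le> n \<Longrightarrow> norm (S r \<omega>) \<le> R \<omega>"
  unfolding S_def by (rule norm_sum_X_le) auto

lemma S_diff: "j \<le> l \<Longrightarrow> S l \<omega> - S j \<omega> = (\<Sum>k=Suc j..l. X k \<omega>)"
  unfolding S_def by (induct l rule: dec_induct) auto

lemma norm_S_diff_le: "j \<le> l \<Longrightarrow> l \<le> n \<Longrightarrow> norm (S l \<omega> - S j \<omega>) \<le> R \<omega>"
  by (simp add: S_diff norm_sum_X_le)

lemma norm_Y_le:
  assumes N: "N > 0" and m: "m \<le> n * N" shows "norm (Y N m \<omega>) \<le> R \<omega>"
\<comment> \<open>The last grid point is separate: the formula for its block refers to
  \<open>X (Suc n)\<close>, which \<open>R\<close> does not control.\<close>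
proof (cases "m = n * N")
  case True then show ?thesis using N norm_S_le[of n] by (simp add: Y_def S_def)
next
  case False
  then have r: "m div N < n" using m N by (simp add: div_less_iff_less_mult)
  define \<theta> where "\<theta> = real (m mod N) / real N"
  have \<theta>: "0 \<le> \<theta>" "\<theta> \<le> 1" using N by (auto simp: \<theta>_def intro: less_imp_le)
  have "Y N m \<omega> = (1 - \<theta>) *\<^sub>R S (m div N) \<omega> + \<theta> *\<^sub>R S (Suc (m div N)) \<omega>"
    by (simp add: Y_def grid_path_def S_def \<theta>_def algebra_simps)
  also have "norm \<dots> \<le> (1 - \<theta>) * norm (S (m div N) \<omega>) + \<theta> * norm (S (Suc (m div N)) \<omega>)"
    using \<theta> by (intro order_trans[OF norm_triangle_ineq]) auto
  also have "\<dots> \<le> (1 - \<theta>) * R \<omega> + \<theta> * R \<omega>"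
    using \<theta> r by (intro add_mono mult_left_mono norm_S_le) auto
  finally show ?thesis by (simp add: algebra_simps)
qed

lemma Y_Suc: "N > 0 \<Longrightarrow> Y N (Suc i) \<omega> = Y N i \<omega> + (1 / real N) *\<^sub>R X (Suc (i div N)) \<omega>"
  unfolding Y_def by (rule grid_path_Suc)

lemma Y_measurable_F:
  shows "Y N i \<in> borel_measurable (F (Suc (i div N)))"
    and "N > 0 \<Longrightarrow> Y N (Suc i) \<in> borel_measurable (F (Suc (i div N)))"
proof -
  have [measurable]: "X k \<in> borel_measurable (F (Suc (i div N)))" if "k \<in> {1..Suc (i div N)}" for k
    using that by (intro X_measurable_F) auto
  show 1: "Y N i \<in> borel_measurable (F (Suc (i div N)))"
    unfolding Y_def grid_path_def
    by (intro borel_measurable_add borel_measurable_sum borel_measurable_scaleR borel_measurable_const) auto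
  assume N: "N > 0"
  \<comment> \<open>The right endpoint is written with the increment of the current block. If
    \<open>Suc i\<close> opens a new block, the first claim at \<open>Suc i\<close> would give only
    a later \<sigma>-algebra.\<close>
  have eq: "Y N (Suc i) = (\<lambda>\<omega>. Y N i \<omega> + (1 / real N) *\<^sub>R X (Suc (i div N)) \<omega>)" using Y_Suc[OF N] by blast
  show "Y N (Suc i) \<in> borel_measurable (F (Suc (i div N)))"
    unfolding eq by (intro borel_measurable_add 1 borel_measurable_scaleR borel_measurable_const) auto
qed

lemma Y_measurable [measurable]: "Y N i \<in> borel_measurable M"
  using measurable_from_subalg[OF sub Y_measurable_F(1)] .

lemma S_measurable [measurable]: "S r \<in> borel_measurable M"
  unfolding S_def by (intro borel_measurable_sum X_measurable) auto

section \<open>Conditional expectations of gradient increments\<close>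

lemma is_cond_expB_T:
  assumes "j \<le> l"
  shows "is_cond_expB M (F (Suc j)) (\<lambda>\<omega>. S l \<omega> - S j \<omega>) (T (Suc j) l)"
  unfolding S_diff[OF assms] T_def
  by (intro is_cond_expB_sum sub cond_expB_is_cond_expB X1) auto

lemma S_diff_integrable: "j \<le> l \<Longrightarrow> integrable M (\<lambda>\<omega>. S l \<omega> - S j \<omega>)"
  unfolding S_diff by (intro Bochner_Integration.integrable_sum X1) auto

lemma T_measurable: "j \<le> l \<Longrightarrow> T (Suc j) l \<in> borel_measurable M"
  using is_cond_expB_T[of j l] by (auto simp: is_cond_expB_def)

lemma S_diff_powr_integrable:
  "j \<le> l \<Longrightarrow> l \<le> n \<Longrightarrow> integrable M (\<lambda>\<omega>. norm (S l \<omega> - S j \<omega>) powr p)"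
  using norm_S_diff_le by (intro integrable_powr_le_R[where K=1]) auto

lemma T_powr_integrable:
  assumes "j \<le> l" "l \<le> n" shows "integrable M (\<lambda>\<omega>. norm (T (Suc j) l \<omega>) powr p)"
  using assms p
  by (intro integrable_norm_powr_cond_expB[OF sub S_diff_integrable is_cond_expB_T] S_diff_powr_integrable) auto

lemma apply_measurable:
  assumes [measurable]: "f \<in> borel_measurable M" "Z \<in> borel_measurable M"
  shows "(\<lambda>\<omega>. D1 (f \<omega>) (Z \<omega>)) \<in> borel_measurable M"
proof -
  have "continuous_on UNIV (\<lambda>z. D1 (fst z) (snd z))"
    by (intro continuous_intros continuous_on_compose2[OF cont_D1]) auto
  from borel_measurable_continuous_on[OF this, of "\<lambda>x. (f x, Z x)" M] show ?thesis by simp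
qed

lemma D1_Y_integrable:
  assumes "N > 0" "m \<le> n * N" and Z: "Z \<in> borel_measurable M" "integrable M (\<lambda>\<omega>. norm (Z \<omega>) powr p)"
  shows "integrable M (\<lambda>\<omega>. D1 (Y N m \<omega>) (Z \<omega>))"
proof (rule integrable_product_le_R[OF apply_measurable[OF Y_measurable Z(1)] _ _ Z(2)])
  fix \<omega>
  have "\<bar>D1 (Y N m \<omega>) (Z \<omega>)\<bar> \<le> norm (D1 (Y N m \<omega>)) * norm (Z \<omega>)"
    using norm_blinfun[of "D1 (Y N m \<omega>)" "Z \<omega>"] by simp
  also have "\<dots> \<le> (C * norm (Y N m \<omega>) powr (p - 1)) * norm (Z \<omega>)"
    by (intro mult_right_mono norm_D1_le) auto
  also have "\<dots> \<le> (C * R \<omega> powr (p - 1)) * norm (Z \<omega>)"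
    using assms norm_Y_le p C by (intro mult_right_mono mult_left_mono powr_mono2) auto
  finally show "\<bar>D1 (Y N m \<omega>) (Z \<omega>)\<bar> \<le> C * R \<omega> powr (p - 1) * norm (Z \<omega>)" .
qed (use C in simp)

lemma DY_integrable:
  assumes "N > 0" "i < n * N" "Z \<in> borel_measurable M" "integrable M (\<lambda>\<omega>. norm (Z \<omega>) powr p)"
  shows "integrable M (\<lambda>\<omega>. DY N i \<omega> (Z \<omega>))"
  unfolding DY_def blinfun.diff_left
  using assms by (intro Bochner_Integration.integrable_diff D1_Y_integrable) auto

text \<open>A set of \<open>F 0\<close> also lies in \<open>F (Suc j)\<close>, for which the
  gradient at the grid point is measurable; its growth of order \<open>p - 1\<close> matches the
  pull-out rule.\<close>

lemma D1_Y_pull_out: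
  assumes N: "N > 0" and m: "m \<le> n * N" and jl: "j \<le> l" "l \<le> n"
    and Ym: "Y N m \<in> borel_measurable (F (Suc j))" and A: "A \<in> sets (F 0)"
  shows "(\<integral>\<omega>. indicator A \<omega> *\<^sub>R D1 (Y N m \<omega>) (S l \<omega> - S j \<omega>) \<partial>M)
       = (\<integral>\<omega>. indicator A \<omega> *\<^sub>R D1 (Y N m \<omega>) (T (Suc j) l \<omega>) \<partial>M)"
proof -
  have i: "integrable M (\<lambda>\<omega>. norm (Y N m \<omega>) powr (p - 1) * norm (Z \<omega>))"
    if [measurable]: "Z \<in> borel_measurable M" and Z: "integrable M (\<lambda>\<omega>. norm (Z \<omega>) powr p)" for Z :: "'a \<Rightarrow> 'b"
  proof (rule integrable_product_le_R[where K=1, OF _ _ _ Z])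
    show "\<bar>norm (Y N m \<omega>) powr (p - 1) * norm (Z \<omega>)\<bar> \<le> 1 * R \<omega> powr (p - 1) * norm (Z \<omega>)" for \<omega>
      using norm_Y_le[OF N m] p by (auto simp: abs_mult intro!: mult_right_mono powr_mono2)
  qed auto
  show ?thesis
  proof (rule is_cond_expB_pull_out[OF sub S_diff_integrable[OF jl(1)] is_cond_expB_T[OF jl(1)] Ym _ cont_D1 norm_D1_le])
    show "A \<in> sets (F (Suc j))" using A sets_F_mono[of 0 "Suc j"] by auto
  qed (use p C i S_diff_powr_integrable[OF jl] T_powr_integrable[OF jl] T_measurable[OF jl(1)] in auto)
qed

text \<open>Both endpoints of grid step \<open>i\<close> are \<open>F (Suc j)\<close>-measurable, so
  each of the two gradients can be pulled out before conditioning on \<open>F 0\<close>.\<close>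

lemma cond_exp_DY_S_diff:
  assumes N: "N > 0" and i: "i < n * N" and jl: "j = i div N" "j \<le> l" "l \<le> n"
  shows "AE \<omega> in M. real_cond_exp M (F 0) (\<lambda>\<omega>. DY N i \<omega> (S l \<omega> - S j \<omega>)) \<omega>
       = real_cond_exp M (F 0) (\<lambda>\<omega>. DY N i \<omega> (T (Suc j) l \<omega>)) \<omega>"
proof -
  interpret F0: finite_measure_subalgebra M "F 0" by (rule F0_locale)
  have iS: "integrable M (\<lambda>\<omega>. DY N i \<omega> (S l \<omega> - S j \<omega>))" and iT: "integrable M (\<lambda>\<omega>. DY N i \<omega> (T (Suc j) l \<omega>))"
    using N i jl S_diff_powr_integrable T_powr_integrable T_measurable by (auto intro!: DY_integrable)
  show ?thesis
  proof (rule F0.real_cond_exp_charact[OF _ iS F0.real_cond_exp_int(1)[OF iT]])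
    fix A assume A: "A \<in> sets (F 0)"
    then have AM: "A \<in> sets M" using sub[of 0] by (auto simp: subalgebra_def)
    have int: "integrable M (\<lambda>\<omega>. indicator A \<omega> *\<^sub>R D1 (Y N m \<omega>) (Z \<omega>))"
      if "m \<le> n * N" "Z \<in> borel_measurable M" "integrable M (\<lambda>\<omega>. norm (Z \<omega>) powr p)" for m Z
      using that N by (intro integrable_mult_indicator AM D1_Y_integrable) auto
    have "(\<integral>\<omega>. indicator A \<omega> *\<^sub>R DY N i \<omega> (S l \<omega> - S j \<omega>) \<partial>M) = (\<integral>\<omega>. indicator A \<omega> *\<^sub>R DY N i \<omega> (T (Suc j) l \<omega>) \<partial>M)"
      unfolding DY_def blinfun.diff_left scaleR_diff_right
      using N i jl A Y_measurable_F[where N=N and i=i] S_diff_powr_integrable[OF jl(2,3)]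
        T_powr_integrable[OF jl(2,3)] T_measurable[OF jl(2)]
      by (subst (1 2) Bochner_Integration.integral_diff) (auto simp del: real_scaleR_def simp: D1_Y_pull_out intro!: int)
    then show "(\<integral>\<omega>\<in>A. DY N i \<omega> (S l \<omega> - S j \<omega>) \<partial>M)
      = (\<integral>\<omega>\<in>A. real_cond_exp M (F 0) (\<lambda>\<omega>. DY N i \<omega> (T (Suc j) l \<omega>)) \<omega> \<partial>M)"
      using F0.real_cond_exp_intA[OF iT A] by (simp add: set_lebesgue_integral_def)
  qed simp
qed

text \<open>Covers both the oscillation of \<open>|\<cdot>|\<^sup>p\<close> over one grid step and the shift by \<open>1 / N\<close>, which keeps the base of
  the power \<open>1 - 2 / p\<close> positive; this is needed for \<open>p = 2\<close>, since \<open>0 powr 0 = 0\<close>.\<close>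

definition Err where "Err N \<omega> = (p * real_cond_exp M (F 0) (\<lambda>\<omega>. R \<omega> powr p) \<omega> + 1) / real N"

lemma V_integrable:
  assumes jl: "j \<le> l" "l \<le> n" "j < n"
  shows "integrable M (V (Suc j) l)"
proof -
  note [measurable] = T_measurable[OF jl(1)] X_measurable[of "Suc j"]
  have ab: "a powr (p / 2) * b powr (p / 2) \<le> a powr p + b powr p" if "0 \<le> a" "0 \<le> b" for a b :: real
  proof -
    have "a powr (p / 2) * b powr (p / 2) \<le> max a b powr (p / 2) * max a b powr (p / 2)"
      using that p by (intro mult_mono powr_mono2) auto
    also have "\<dots> = max a b powr p" by (simp add: powr_add[symmetric])
    also have "\<dots> \<le> a powr p + b powr p" by (simp add: max_def)
    finally show ?thesis .
  qed
  have i: "integrable M (\<lambda>\<omega>. norm (X (Suc j) \<omega>) powr p + norm (T (Suc j) l \<omega>) powr p)"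
    using Xp[of "Suc j"] T_powr_integrable[OF jl(1,2)] by auto
  show ?thesis
    unfolding V_def
    by (rule Bochner_Integration.integrable_bound[OF i])
      (auto intro!: AE_I2 ab simp: abs_mult)
qed

lemma V_nonneg: "0 \<le> V i l \<omega>" by (simp add: V_def)

lemma cond_exp_V_le_B:
  assumes "i \<le> l" "l \<le> n"
  shows "real_cond_exp M (F 0) (V i l) \<omega> powr (2 / p) \<le> B i \<omega>"
  unfolding B_def using assms by (intro Max_ge) auto

lemma B_nonneg: "i \<le> n \<Longrightarrow> 0 \<le> B i \<omega>"
  using cond_exp_V_le_B[of i i \<omega>] powr_ge_zero order_trans by blast

lemma Err_pos: "AE \<omega> in M. \<forall>N>0. 0 < Err N \<omega>"
proof -
  interpret F0: finite_measure_subalgebra M "F 0" by (rule F0_locale)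
  have "AE \<omega> in M. 0 \<le> real_cond_exp M (F 0) (\<lambda>\<omega>. R \<omega> powr p) \<omega>"
    by (rule F0.real_cond_exp_pos) auto
  then show ?thesis
    by eventually_elim (use p in \<open>auto simp: Err_def intro!: divide_pos_pos add_nonneg_pos\<close>)
qed

text \<open>After replacing the increment by \<open>T\<close>, the Lipschitz bound leaves
  \<open>norm (X (Suc j) \<omega>) * norm (T (Suc j) l \<omega>)\<close> times a power of
  \<open>u\<close>; conditional Hoelder with exponent 2 / p separates the two. The bound is the same
  for every admissible \<open>l\<close>.\<close>

lemma cond_exp_DY_le:
  assumes N: "N > 0" and i: "i < n * N" and jl: "j = i div N" "j \<le> l" "l \<le> n"
  shows "AE \<omega> in M. real_cond_exp M (F 0) (\<lambda>\<omega>. DY N i \<omega> (S l \<omega> - S j \<omega>)) \<omega> \<le>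
    C / real N * B (Suc j) \<omega> *
      (real_cond_exp M (F 0) (\<lambda>\<omega>. norm (Y N i \<omega>) powr p) \<omega> + Err N \<omega>) powr (1 - 2 / p)"
proof -
  interpret F0: finite_measure_subalgebra M "F 0" by (rule F0_locale)
  have jn: "j < n" using N i jl by (simp add: div_less_iff_less_mult)
  have Ym: "norm (Y N m \<omega>) \<le> R \<omega>" if "m \<le> n * N" for m \<omega> using norm_Y_le[OF N that] .
  \<comment> \<open>The maximum meets the hypothesis of the Lipschitz bound at both ends of the
    step; the shift 1 / N is the positive lower bound that Hoelder requires.\<close>
  define u where "u \<omega> = max (norm (Y N i \<omega>) powr p) (norm (Y N (Suc i) \<omega>) powr p) + 1 / real N" for \<omega>
  have iY: "integrable M (\<lambda>\<omega>. norm (Y N m \<omega>) powr p)" if "m \<le> n * N" for m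
    using Ym[OF that] by (intro integrable_powr_le_R[where K=1]) auto
  have u_int: "integrable M u"
    unfolding u_def using i by (intro Bochner_Integration.integrable_add integrable_max iY) auto
  have u_ge: "1 / real N \<le> u \<omega>" for \<omega> by (simp add: u_def le_max_iff_disj)
  have u_le: "u \<omega> \<le> norm (Y N i \<omega>) powr p + (p * R \<omega> powr p + 1) / real N" for \<omega>
  proof -
    have "norm (Y N (Suc i) \<omega>) \<le> norm (Y N i \<omega>) + norm ((1 / real N) *\<^sub>R X (Suc j) \<omega>)"
      unfolding Y_Suc[OF N] jl(1) by (rule norm_triangle_ineq)
    also have "norm ((1 / real N) *\<^sub>R X (Suc j) \<omega>) \<le> R \<omega> * (1 / real N)"
      using norm_X_le[of "Suc j" \<omega>] jn N by (simp add: divide_right_mono)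
    finally have "norm (Y N (Suc i) \<omega>) powr p \<le> norm (Y N i \<omega>) powr p + p * R \<omega> powr p * (1 / real N)"
      using Ym[of "Suc i" \<omega>] i p by (intro powr_le_powr_add) auto
    moreover have "0 \<le> p * R \<omega> powr p * (1 / real N)" using p by auto
    ultimately show ?thesis unfolding u_def by (simp add: add_divide_distrib)
  qed
  let ?E = "real_cond_exp M (F 0)"
  have Eu: "AE \<omega> in M. ?E u \<omega> \<le> ?E (\<lambda>\<omega>. norm (Y N i \<omega>) powr p) \<omega> + Err N \<omega>"
  proof -
    have i1: "integrable M (\<lambda>\<omega>. p * R \<omega> powr p)" using integrable_R_powr by auto
    have i2: "integrable M (\<lambda>\<omega>. p * R \<omega> powr p + 1)" using i1 by auto
    have i3: "integrable M (\<lambda>\<omega>. (p * R \<omega> powr p + 1) / real N)" using i2 by auto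
    have iYi: "integrable M (\<lambda>\<omega>. norm (Y N i \<omega>) powr p)" using iY i by simp
    have "AE \<omega> in M. ?E u \<omega> \<le> ?E (\<lambda>\<omega>. norm (Y N i \<omega>) powr p + (p * R \<omega> powr p + 1) / real N) \<omega>"
      using u_le by (intro F0.real_cond_exp_mono[OF _ u_int Bochner_Integration.integrable_add[OF iYi i3]]) auto
    moreover note F0.real_cond_exp_add[OF iYi i3] F0.real_cond_exp_cdiv[OF i2, of "real N"]
      F0.real_cond_exp_cmult[OF integrable_R_powr, of p]
    moreover have "AE \<omega> in M. ?E (\<lambda>\<omega>. p * R \<omega> powr p + 1) \<omega> = ?E (\<lambda>\<omega>. p * R \<omega> powr p) \<omega> + ?E (\<lambda>\<omega>. 1) \<omega>"
      using i1 by (intro F0.real_cond_exp_add) auto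
    moreover have "AE \<omega> in M. ?E (\<lambda>\<omega>. 1) \<omega> = 1" by (rule F0.real_cond_exp_F_meas) auto
    ultimately show ?thesis
    proof eventually_elim
      case (elim \<omega>)
      show ?case using elim(1) unfolding elim(2-6) Err_def .
    qed
  qed
  have Holder: "integrable M (\<lambda>\<omega>. u \<omega> powr (1 - 2 / p) * V (Suc j) l \<omega> powr (2 / p))"
    "AE \<omega> in M. ?E (\<lambda>\<omega>. u \<omega> powr (1 - 2 / p) * V (Suc j) l \<omega> powr (2 / p)) \<omega>
      \<le> ?E u \<omega> powr (1 - 2 / p) * ?E (V (Suc j) l) \<omega> powr (2 / p)"
    using F0.real_cond_exp_Holder[OF u_int V_integrable[OF jl(2,3) jn] _ u_ge V_nonneg, of "2 / p"] N p by auto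
  have DY_le: "DY N i \<omega> (T (Suc j) l \<omega>) \<le> C / real N * (u \<omega> powr (1 - 2 / p) * V (Suc j) l \<omega> powr (2 / p))" for \<omega>
  proof -
    have "0 < u \<omega>" using u_ge[of \<omega>] N by (meson less_le_trans of_nat_0_less_iff zero_less_divide_1_iff)
    then have "\<bar>DY N i \<omega> (T (Suc j) l \<omega>)\<bar> \<le>
        C * norm (Y N (Suc i) \<omega> - Y N i \<omega>) * norm (T (Suc j) l \<omega>) * u \<omega> powr (1 - 2 / p)"
      unfolding DY_def using C by (intro derivative_norm_powr_lipschitz[OF p _ D2 bound]) (auto simp: u_def intro!: add_increasing2)
    also have "norm (Y N (Suc i) \<omega> - Y N i \<omega>) = norm (X (Suc j) \<omega>) / real N"
      using N by (simp add: Y_Suc jl(1))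
    also have "C * (norm (X (Suc j) \<omega>) / real N) * norm (T (Suc j) l \<omega>) * u \<omega> powr (1 - 2 / p)
      = C / real N * (u \<omega> powr (1 - 2 / p) * (norm (X (Suc j) \<omega>) * norm (T (Suc j) l \<omega>)))" by simp
    also have "norm (X (Suc j) \<omega>) * norm (T (Suc j) l \<omega>) = V (Suc j) l \<omega> powr (2 / p)"
      using p by (simp add: V_def powr_mult powr_powr)
    finally show ?thesis by linarith
  qed
  have EV: "AE \<omega> in M. ?E (V (Suc j) l) \<omega> powr (2 / p) \<le> B (Suc j) \<omega>"
  proof (cases "l = j")
    \<comment> \<open>For \<open>l = j\<close> the sum \<open>T\<close> is empty and
      \<open>l\<close> is outside the range of the maximum in \<open>B\<close>; nonnegativity of
      \<open>B\<close> settles this case.\<close>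
    case True
    then have "V (Suc j) l = (\<lambda>_. 0)" using p by (auto simp: V_def T_def)
    moreover have "AE \<omega> in M. ?E (\<lambda>_. 0) \<omega> = 0" by (rule F0.real_cond_exp_F_meas) auto
    then have "AE \<omega> in M. ?E (\<lambda>_. 0) \<omega> powr (2 / p) \<le> B (Suc j) \<omega>"
      by eventually_elim (use B_nonneg[of "Suc j"] jn in simp)
    ultimately show ?thesis by (simp only:)
  next
    case False
    then show ?thesis using cond_exp_V_le_B jl by (intro AE_I2) auto
  qed
  have "AE \<omega> in M. ?E (\<lambda>\<omega>. DY N i \<omega> (T (Suc j) l \<omega>)) \<omega>
      \<le> ?E (\<lambda>\<omega>. C / real N * (u \<omega> powr (1 - 2 / p) * V (Suc j) l \<omega> powr (2 / p))) \<omega>"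
    by (rule F0.real_cond_exp_mono[OF _ DY_integrable integrable_mult_right])
      (use DY_le N i jl T_measurable T_powr_integrable Holder(1) in auto)
  moreover note F0.real_cond_exp_cmult[OF Holder(1), of "C / real N"] Holder(2) Eu EV
    cond_exp_DY_S_diff[OF N i jl]
  moreover have "AE \<omega> in M. 0 \<le> ?E u \<omega>"
    using u_int by (intro F0.real_cond_exp_pos AE_I2 order_trans[OF _ u_ge]) auto
  ultimately show ?thesis
  proof eventually_elim
    case (elim \<omega>)
    have "?E (\<lambda>\<omega>. DY N i \<omega> (S l \<omega> - S j \<omega>)) \<omega> \<le>
      C / real N * ?E (\<lambda>\<omega>. u \<omega> powr (1 - 2 / p) * V (Suc j) l \<omega> powr (2 / p)) \<omega>"
      using elim(1) unfolding elim(2,6) .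
    also have "\<dots> \<le> C / real N * (?E u \<omega> powr (1 - 2 / p) * ?E (V (Suc j) l) \<omega> powr (2 / p))"
      using elim(3) C by (intro mult_left_mono) auto
    also have "\<dots> \<le> C / real N *
      ((?E (\<lambda>\<omega>. norm (Y N i \<omega>) powr p) \<omega> + Err N \<omega>) powr (1 - 2 / p) * B (Suc j) \<omega>)"
      using elim(4,5,7) C p by (intro mult_left_mono mult_mono powr_mono2) auto
    finally show ?case by (simp add: algebra_simps)
  qed
qed

section \<open>Summation over the grid and passage to the limit\<close>

text \<open>The test vector of each gradient increment is a convex combination of the partial sum
  differences with upper ends \<open>r\<close> and \<open>r'\<close>. As the bound of
  \<open>cond_exp_DY_le\<close> is independent of the upper end, the combination obeys it
  too.\<close>

lemma cond_exp_grid_path_le: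
  assumes N: "N > 0" and m: "m \<le> n * N"
  shows "AE \<omega> in M. real_cond_exp M (F 0) (\<lambda>\<omega>. norm (Y N m \<omega>) powr p) \<omega> \<le>
    (\<Sum>i<m. C / real N * B (Suc (i div N)) \<omega> *
      (real_cond_exp M (F 0) (\<lambda>\<omega>. norm (Y N i \<omega>) powr p) \<omega> + Err N \<omega>) powr (1 - 2 / p))"
    (is "AE \<omega> in M. _ \<le> (\<Sum>i<m. ?G i \<omega>)")
proof -
  interpret F0: finite_measure_subalgebra M "F 0" by (rule F0_locale)
  let ?E = "real_cond_exp M (F 0)"
  define r where "r = m div N"
  \<comment> \<open>At the final grid point \<open>Suc r\<close> would exceed \<open>n\<close>;
    there \<theta> is 0, so the capped value is harmless.\<close>
  define r' where "r' = min (Suc r) n"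
  define \<theta> where "\<theta> = real (m mod N) / real N"
  have \<theta>: "0 \<le> \<theta>" "\<theta> \<le> 1" using N by (auto simp: \<theta>_def intro: less_imp_le)
  have rn: "r \<le> n" unfolding r_def using m N by (metis div_le_mono div_mult_self_is_m mult.commute)
  define Q where "Q i l \<omega> = DY N i \<omega> (S l \<omega> - S (i div N) \<omega>)" for i l \<omega>
  have ir: "i div N \<le> r" "i div N \<le> r'" "i < n * N" if "i < m" for i
    using that m rn N div_le_mono[of i m N] by (auto simp: r_def r'_def)
  have Qi: "integrable M (Q i l)" if "i < m" "i div N \<le> l" "l \<le> n" for i l
    unfolding Q_def using that ir N S_diff_powr_integrable by (intro DY_integrable) auto
  have path: "norm (Y N m \<omega>) powr p \<le> (\<Sum>i<m. (1 - \<theta>) * Q i r \<omega> + \<theta> * Q i r' \<omega>)" for \<omega>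
  proof -
    have e: "Y N m \<omega> - S j \<omega> = (1 - \<theta>) *\<^sub>R (S r \<omega> - S j \<omega>) + \<theta> *\<^sub>R (S r' \<omega> - S j \<omega>)" for j
    proof (cases "r = n")
      case True
      then have "m = n * N" using m N by (metis div_times_less_eq_dividend le_antisym r_def)
      then have "\<theta> = 0" by (simp add: \<theta>_def)
      then show ?thesis unfolding Y_def S_def grid_path_diff r_def \<theta>_def by simp
    next
      case False
      then have "r' = Suc r" using rn by (simp add: r'_def)
      then show ?thesis unfolding Y_def S_def grid_path_diff r_def \<theta>_def by simp
    qed
    have "norm (Y N m \<omega>) powr p \<le> (\<Sum>i<m. DY N i \<omega> (Y N m \<omega> - S (i div N) \<omega>))"
      unfolding DY_def Y_def S_def using p N by (intro norm_powr_grid_path_le D1 D1_0) auto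
    also have "\<dots> = (\<Sum>i<m. (1 - \<theta>) * Q i r \<omega> + \<theta> * Q i r' \<omega>)"
      unfolding e Q_def by (simp add: blinfun.add_right blinfun.scaleR_right)
    finally show ?thesis .
  qed
  have r'n: "r' \<le> n" by (simp add: r'_def)
  have iY: "integrable M (\<lambda>\<omega>. norm (Y N m \<omega>) powr p)"
    using norm_Y_le[OF N m] by (intro integrable_powr_le_R[where K=1]) auto
  have i1: "integrable M (\<lambda>\<omega>. (1 - \<theta>) * Q i r \<omega>)" and i2: "integrable M (\<lambda>\<omega>. \<theta> * Q i r' \<omega>)" if "i < m" for i
    using Qi[OF that ir(1)[OF that] rn] Qi[OF that ir(2)[OF that] r'n] by auto
  have i12: "integrable M (\<lambda>\<omega>. (1 - \<theta>) * Q i r \<omega> + \<theta> * Q i r' \<omega>)" if "i < m" for i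
    using i1[OF that] i2[OF that] by (rule Bochner_Integration.integrable_add)
  have "AE \<omega> in M. ?E (\<lambda>\<omega>. norm (Y N m \<omega>) powr p) \<omega> \<le> ?E (\<lambda>\<omega>. \<Sum>i<m. (1 - \<theta>) * Q i r \<omega> + \<theta> * Q i r' \<omega>) \<omega>"
    using path i12 by (intro F0.real_cond_exp_mono[OF _ iY] Bochner_Integration.integrable_sum) auto
  moreover have "AE \<omega> in M. ?E (\<lambda>\<omega>. \<Sum>i<m. (1 - \<theta>) * Q i r \<omega> + \<theta> * Q i r' \<omega>) \<omega>
    = (\<Sum>i<m. ?E (\<lambda>\<omega>. (1 - \<theta>) * Q i r \<omega> + \<theta> * Q i r' \<omega>) \<omega>)"
    using i12 by (intro F0.real_cond_exp_sum_on) auto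
  moreover have "AE \<omega> in M. \<forall>i\<in>{..<m}. ?E (\<lambda>\<omega>. (1 - \<theta>) * Q i r \<omega> + \<theta> * Q i r' \<omega>) \<omega> \<le> ?G i \<omega>"
  proof (subst AE_ball_countable)
    show "\<forall>i\<in>{..<m}. AE \<omega> in M. ?E (\<lambda>\<omega>. (1 - \<theta>) * Q i r \<omega> + \<theta> * Q i r' \<omega>) \<omega> \<le> ?G i \<omega>"
    proof
      fix i assume "i \<in> {..<m}"
      then have im: "i < m" by simp
      note F0.real_cond_exp_add[OF i1[OF im] i2[OF im]]
        F0.real_cond_exp_cmult[OF Qi[OF im ir(1)[OF im] rn], of "1 - \<theta>"]
        F0.real_cond_exp_cmult[OF Qi[OF im ir(2)[OF im] r'n], of \<theta>]
        cond_exp_DY_le[OF N ir(3)[OF im] refl ir(1)[OF im] rn, folded Q_def]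
        cond_exp_DY_le[OF N ir(3)[OF im] refl ir(2)[OF im] r'n, folded Q_def]
      then show "AE \<omega> in M. ?E (\<lambda>\<omega>. (1 - \<theta>) * Q i r \<omega> + \<theta> * Q i r' \<omega>) \<omega> \<le> ?G i \<omega>"
      proof eventually_elim
        case (elim \<omega>)
        have "(1 - \<theta>) * ?E (Q i r) \<omega> + \<theta> * ?E (Q i r') \<omega> \<le> (1 - \<theta>) * ?G i \<omega> + \<theta> * ?G i \<omega>"
          using elim(4,5) \<theta> by (intro add_mono mult_left_mono) auto
        also have "\<dots> = ?G i \<omega>" by (simp only: distrib_right[symmetric]) simp
        finally show ?case unfolding elim(1-3) .
      qed
    qed
  qed simp
  ultimately show ?thesis
  proof eventually_elim
    case (elim \<omega>)
    then show ?case by (force intro: order_trans sum_mono)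
  qed
qed

text \<open>For a fixed \<omega> outside one null set, \<open>discrete_Bihari\<close> is applied
  along the grid with \<alpha> = 2 / p and shift \<open>Err N \<omega>\<close>. The weights sum to
  \<open>C * b\<close> for every \<open>N\<close>, while the shift vanishes as \<open>N\<close>
  grows.\<close>

lemma cond_exp_norm_S_le:
  "AE \<omega> in M. real_cond_exp M (F 0) (\<lambda>\<omega>. norm (S n \<omega>) powr p) \<omega> \<le> (2 / p * C * (\<Sum>i=1..n. B i \<omega>)) powr (p / 2)"
proof -
  interpret F0: finite_measure_subalgebra M "F 0" by (rule F0_locale)
  let ?E = "real_cond_exp M (F 0)"
  let ?f = "\<lambda>N m \<omega>. ?E (\<lambda>\<omega>. norm (Y N m \<omega>) powr p) \<omega>"
  \<comment> \<open>All grids and grid points are handled on a single null set, since the rest of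
    the argument is pointwise.\<close>
  have "AE \<omega> in M. \<forall>N m. N > 0 \<longrightarrow> m \<le> n * N \<longrightarrow> ?f N m \<omega> \<le>
    (\<Sum>i<m. C / real N * B (Suc (i div N)) \<omega> * (?f N i \<omega> + Err N \<omega>) powr (1 - 2 / p))"
    unfolding AE_all_countable using cond_exp_grid_path_le by auto
  moreover have "AE \<omega> in M. \<forall>N m. 0 \<le> ?f N m \<omega>"
    unfolding AE_all_countable by (intro allI F0.real_cond_exp_pos) auto
  ultimately show ?thesis using Err_pos
  proof eventually_elim
    case (elim \<omega>)
    define e where "e = ?E (\<lambda>\<omega>. norm (S n \<omega>) powr p) \<omega>"
    define b where "b = (\<Sum>i=1..n. B i \<omega>)"
    have b0: "0 \<le> b" unfolding b_def by (intro sum_nonneg B_nonneg) auto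
    have fe: "?f N (n * N) \<omega> = e" if "N > 0" for N
      using that by (simp add: e_def Y_def S_def)
    have e0: "0 \<le> e" using elim(2) fe[of 1] by (metis zero_less_one)
    have step: "e powr (2 / p) \<le> Err N \<omega> powr (2 / p) + 2 / p * (C * b)" if N: "N > 0" for N
    proof -
      have "(?f N (n * N) \<omega> + Err N \<omega>) powr (2 / p)
          \<le> Err N \<omega> powr (2 / p) + 2 / p * (\<Sum>i<n * N. C / real N * B (Suc (i div N)) \<omega>)"
      proof (rule discrete_Bihari)
        fix i assume "i < n * N"
        then have "Suc (i div N) \<le> n" using N by (simp add: div_less_iff_less_mult Suc_le_eq)
        then show "0 \<le> C / real N * B (Suc (i div N)) \<omega>" using C B_nonneg by auto
      qed (use elim N p in auto)
      \<comment> \<open>Each of the \<open>n\<close> blocks repeats its value \<open>N\<close>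
        times, which cancels the factor 1 / N.\<close>
      also have "(\<Sum>i<n * N. C / real N * B (Suc (i div N)) \<omega>) = C * b"
        using N by (subst sum_div_eq) (auto simp: b_def sum_distrib_left[symmetric] sum_divide_distrib[symmetric] sum.shift_bounds_Suc_ivl sum.atLeast1_atMost_eq)
      finally have "(e + Err N \<omega>) powr (2 / p) \<le> Err N \<omega> powr (2 / p) + 2 / p * (C * b)"
        by (simp add: fe N)
      moreover have "e powr (2 / p) \<le> (e + Err N \<omega>) powr (2 / p)"
        using e0 elim(3) N p by (intro powr_mono2) (auto simp: less_imp_le)
      ultimately show ?thesis by simp
    qed
    have "(\<lambda>N. Err N \<omega>) \<longlonglongrightarrow> 0"
      unfolding Err_def by (rule lim_const_over_n)
    then have "(\<lambda>N. Err N \<omega> powr (2 / p) + 2 / p * (C * b)) \<longlonglongrightarrow> 0 powr (2 / p) + 2 / p * (C * b)"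
      using elim(3) p
      by (intro tendsto_add tendsto_const tendsto_powr2)
        (auto simp: eventually_sequentially intro!: exI[of _ 1] less_imp_le)
    then have "e powr (2 / p) \<le> 0 powr (2 / p) + 2 / p * (C * b)"
      by (rule LIMSEQ_le_const) (use step in \<open>auto intro!: exI[of _ 1]\<close>)
    then have "(e powr (2 / p)) powr (p / 2) \<le> (2 / p * C * b) powr (p / 2)"
      using p by (intro powr_mono2) (auto simp: mult.assoc)
    moreover have "(e powr (2 / p)) powr (p / 2) = e" using e0 p by (simp add: powr_powr)
    ultimately show ?case by (simp add: e_def b_def)
  qed
qed

end

section \<open>The inequality for spaces in the smoothness class\<close>

theorem theorem2p1:
  fixes M :: "'a measure" and F :: "nat \<Rightarrow> 'a measure"
    and X :: "nat \<Rightarrow> 'a \<Rightarrow> 'b::{banach,second_countable_topology}"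
    and p c :: real and n :: nat
  assumes "prob_space M"
    and "p \<ge> 2"
    and "class_C2 p c TYPE('b)"
    and "\<And>i. subalgebra M (F i)"
    and "\<And>i. sets (F i) \<subseteq> sets (F (Suc i))"
    and "\<And>i. i \<ge> 1 \<Longrightarrow> X i \<in> borel_measurable (F i)"
    and "\<And>i. i \<ge> 1 \<Longrightarrow> integrable M (\<lambda>\<omega>. norm (X i \<omega>) powr p)"
    and "\<And>i. i \<ge> 1 \<Longrightarrow> integrable M (X i) \<and> (\<integral>\<omega>. X i \<omega> \<partial>M) = 0"
  shows "AE \<omega> in M.
    real_cond_exp M (F 0) (\<lambda>\<omega>. norm (\<Sum>i=1..n. X i \<omega>) powr p) \<omega>
    \<le> (sqrt (2 / p) * sqrt (max c (p / 2))) powr p *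
       (\<Sum>i=1..n. Max ((\<lambda>l. (real_cond_exp M (F 0)
            (\<lambda>\<omega>'. norm (X i \<omega>') powr (p / 2) *
                   norm (\<Sum>k=i..l. cond_expB M (F i) (X k) \<omega>') powr (p / 2)) \<omega>)
              powr (2 / p)) ` {i..n})) powr (p / 2)"
proof -
  let ?C = "max c (p / 2)"
  obtain D1 :: "'b \<Rightarrow> ('b \<Rightarrow>\<^sub>L real)" and D2 :: "'b \<Rightarrow> ('b \<Rightarrow>\<^sub>L ('b \<Rightarrow>\<^sub>L real))" where
    D: "\<And>x. ((\<lambda>y. norm y powr p) has_derivative blinfun_apply (D1 x)) (at x)"
      "\<And>x. (D1 has_derivative blinfun_apply (D2 x)) (at x)"
      "\<And>x u v. \<bar>D2 x u v\<bar> \<le> c * pow0 (norm x) (p - 2) * norm u * norm v"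
    using assms(3) unfolding class_C2_def by blast
  \<comment> \<open>Enlarging \<open>c\<close> only weakens the bound, and the maximum with
    \<open>p / 2\<close> makes the constant positive.\<close>
  have bound: "\<bar>D2 x u v\<bar> \<le> ?C * pow0 (norm x) (p - 2) * norm u * norm v" for x u v
  proof -
    have "c * (pow0 (norm x) (p - 2) * norm u * norm v) \<le> ?C * (pow0 (norm x) (p - 2) * norm u * norm v)"
      by (intro mult_right_mono) (auto simp: pow0_def)
    then show ?thesis using D(3)[of x u v] by (simp only: mult.assoc)
  qed
  interpret prob_space M by (rule assms(1))
  interpret smooth_adapted M F X p ?C n D1 D2
    using assms D bound by unfold_locales auto
  \<comment> \<open>The two square roots combine into a power 1 / 2, which \<open>powr p\<close>
    turns into \<open>p / 2\<close>, the exponent of the sum.\<close>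
  have K: "(sqrt (2 / p) * sqrt ?C) powr p * t powr (p / 2) = (2 / p * ?C * t) powr (p / 2)" if "0 \<le> t" for t
  proof -
    have "(sqrt (2 / p) * sqrt ?C) powr p = ((2 / p * ?C) powr (1 / 2)) powr p"
      using assms(2) by (simp only: real_sqrt_mult[symmetric]) (simp add: powr_half_sqrt)
    also have "\<dots> = (2 / p * ?C) powr (p / 2)" by (simp add: powr_powr)
    finally show ?thesis using assms(2) that powr_mult[of "2 / p * ?C" t "p / 2"] by simp
  qed
  have nn: "0 \<le> (\<Sum>i=1..n. B i \<omega>)" for \<omega> by (intro sum_nonneg B_nonneg) auto
  from cond_exp_norm_S_le show ?thesis
    unfolding K[OF nn, symmetric] unfolding S_def B_def V_def[abs_def] T_def .
qed

end
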